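(* Let $s>1$, $\sigma<1$ and $C>0$. There exists $K=K(C,s,\sigma)$ such that the following holds. Let $\delta>0$ and let $P\subset[0,1]^2$ be a finite set which is $s$-regular above scale $\delta$ with constant $C$. Then there is a set of lines $L\subset\{\ell_{x,y}: x,y\in P\}$ formed from pairs of points of $P$ such that $|L|\geq K^{-1}|P|^2$ and $$\#\{\ell\in L:\theta(\ell)\in I\}\leq K|L|\,|I|^{\sigma}$$ for all intervals $I\subset S^1$ with $|I|\geq\delta$.
   Context: $P$ is $s$-regular above scale $\delta$ with constant $C$ if $|P\cap Q|\leq C|P|w^s$ for every $w\times w$ square $Q$ with $w>\delta$. $\ell_{x,y}$ denotes the line through the distinct points $x,y$; $\theta(\ell)\in S^1$ denotes the direction of the line $\ell$, and $|I|$ is the length of the arc $I$.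
   Formalization: The formal theorem requires δ ≤ δ₀(C,s,σ) for some δ₀ > 0 instead of all δ > 0; as stated the claim fails when Cδ^s ≥ 1, since then any finite P, e.g. N collinear points spanning a single line, is s-regular above scale δ. *)

theory Defs
  imports "HOL-Analysis.Analysis"
begin

definition regular_above_scale ::
    "real \<Rightarrow> real \<Rightarrow> real \<Rightarrow> (real \<times> real) set \<Rightarrow> bool" where
  "regular_above_scale s \<delta> C P \<longleftrightarrow>
     (\<forall>a b w. w > \<delta> \<longrightarrow>
        real (card (P \<inter> ({a..a + w} \<times> {b..b + w}))) \<le> C * real (card P) * w powr s)"

definition spanned_lines :: "(real \<times> real) set \<Rightarrow> (real \<times> real) set set" where
  "spanned_lines P = {affine hull {x, y} | x y. x \<in> P \<and> y \<in> P \<and> x \<noteq> y}"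

(* A line has two antipodal unit direction vectors; both are kept, so that a bound on the
   number of lines with some direction in I holds for every single-valued choice of the
   direction of a line. *)
definition line_directions :: "(real \<times> real) set \<Rightarrow> (real \<times> real) set" where
  "line_directions l = {u. norm u = 1 \<and> (\<exists>p. l = range (\<lambda>t. p + t *\<^sub>R u))}"

(* I is an interval of length r on the unit circle; each endpoint may or may not belong to I. *)
definition circle_interval :: "(real \<times> real) set \<Rightarrow> real \<Rightarrow> bool" where
  "circle_interval I r \<longleftrightarrow> 0 \<le> r \<and> r \<le> 2 * pi \<and>
     (\<exists>a. (\<lambda>t. (cos t, sin t)) ` {a<..<a + r} \<subseteq> I \<and>
          I \<subseteq> (\<lambda>t. (cos t, sin t)) ` {a..a + r})"

(* If 1 \<le> C * \<delta> powr s, then every finite set, for instance a collinear one, is regular above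
   scale \<delta>, and no quadratic lower bound on the number of spanned lines can hold. Hence the
   theorem about spanned lines is only meaningful for \<delta> small in terms of the parameters. *)
lemma no_quadratic_bound_at_coarse_scale:
  fixes s C \<delta> :: real
  assumes "s > 0" "C > 0" "\<delta> > 0" "1 \<le> C * \<delta> powr s"
  shows "\<not> (\<exists>K>0. \<forall>P. finite P \<and> P \<subseteq> {0..1} \<times> {0..1} \<and> regular_above_scale s \<delta> C P \<longrightarrow>
           (\<exists>L \<subseteq> spanned_lines P. real (card L) \<ge> real (card P) ^ 2 / K))"
proof
  assume "\<exists>K>0. \<forall>P. finite P \<and> P \<subseteq> {0..1} \<times> {0..1} \<and> regular_above_scale s \<delta> C P \<longrightarrow>
           (\<exists>L \<subseteq> spanned_lines P. real (card L) \<ge> real (card P) ^ 2 / K)"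
  then obtain K :: real where K: "K > 0"
    and main: "\<forall>P. finite P \<and> P \<subseteq> {0..1} \<times> {0..1} \<and> regular_above_scale s \<delta> C P \<longrightarrow>
           (\<exists>L \<subseteq> spanned_lines P. real (card L) \<ge> real (card P) ^ 2 / K)"
    by (elim exE conjE) (rule that)
  obtain N :: nat where N: "real N > K + 1" using reals_Archimedean2 by blast
  define P :: "(real \<times> real) set" where "P = (\<lambda>i. (real i / real N, 0)) ` {..<N}"
  have Npos: "real N > 0" using N K by linarith
  have cardP: "card P = N"
    unfolding P_def using Npos by (subst card_image) (auto simp: inj_on_def)
  have fin: "finite P" and sub: "P \<subseteq> {0..1} \<times> {0..1}"
    unfolding P_def using Npos by (auto simp: divide_simps)
  have reg: "regular_above_scale s \<delta> C P"
    unfolding regular_above_scale_def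
  proof (intro allI impI)
    fix a b w :: real assume w: "w > \<delta>"
    have "\<delta> powr s \<le> w powr s" using w assms by (intro powr_mono2) auto
    hence "1 \<le> C * w powr s"
      using assms mult_left_mono[of "\<delta> powr s" "w powr s" C] by linarith
    hence "real (card P) \<le> real (card P) * (C * w powr s)"
      using mult_left_mono[of 1 "C * w powr s" "real (card P)"] by simp
    moreover have "card (P \<inter> ({a..a + w} \<times> {b..b + w})) \<le> card P"
      using fin by (intro card_mono) auto
    ultimately show "real (card (P \<inter> ({a..a + w} \<times> {b..b + w}))) \<le> C * real (card P) * w powr s"
      by (simp add: mult_ac)
  qed
  have line: "affine hull {x, y} = UNIV \<times> {0}" if "x \<in> P" "y \<in> P" "x \<noteq> y" for x y
  proof -
    have "snd x = 0" "snd y = 0" using that unfolding P_def by auto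
    then obtain a b where ab: "x = (a, 0)" "y = (b, 0)" "a \<noteq> b"
      using \<open>x \<noteq> y\<close> by (cases x; cases y) auto
    have "(z, 0) \<in> affine hull {x, y}" for z
    proof -
      define t where "t = (z - a) / (b - a)"
      have "z = a + t * (b - a)" using ab(3) by (simp add: t_def)
      hence "(z, 0) = (1 - t) *\<^sub>R x + t *\<^sub>R y" by (simp add: ab algebra_simps)
      moreover have "(1 - t) + t = 1" by simp
      ultimately show ?thesis unfolding affine_hull_2 by blast
    qed
    hence "UNIV \<times> {0} \<subseteq> affine hull {x, y}" by blast
    moreover have "snd v = 0" if "v \<in> affine hull {x, y}" for v
      using that unfolding affine_hull_2 ab(1,2) by auto
    ultimately show ?thesis by (auto simp: mem_Times_iff)
  qed
  have "spanned_lines P \<subseteq> {UNIV \<times> {0}}"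
    unfolding spanned_lines_def using line by auto
  moreover obtain L where L: "L \<subseteq> spanned_lines P" "real (card L) \<ge> real (card P) ^ 2 / K"
    using main[rule_format, OF conjI[OF fin conjI[OF sub reg]]] by (elim exE conjE)
  ultimately have "card L \<le> card {UNIV \<times> {0::real} :: (real \<times> real) set}"
    by (intro card_mono) auto
  hence "real (card L) \<le> 1" by simp
  hence "real N ^ 2 / K \<le> 1" using L(2) unfolding cardP by linarith
  hence "real N ^ 2 \<le> K" using K by (simp only: divide_le_eq_1_pos)
  moreover have "real N ^ 2 \<ge> real N" using N K by (simp add: power2_eq_square)
  ultimately show False using N by linarith
qed

end

theory Submission
  imports Defs
begin

text \<open>
  By regularity few pairs have close abscissae, so slopes may be assumed bounded. Two further kinds
  of pairs are discarded; the lines through the remaining pairs form \<open>L\<close>.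

  Pairs on lines with many points of \<open>P\<close>: by regularity no line contains a positive proportion of
  \<open>P\<close>, so Beck's argument applies. A crossing inequality for straight-line drawings bounds the
  number of \<open>k\<close>-rich lines by a multiple of \<open>n\<^sup>2 / k\<^sup>3 + n / k\<close>, hence most pairs lie on lines with
  boundedly many points.

  Pairs whose slope lies in a dyadic interval of length \<open>r\<close> that contains more than \<open>M n\<^sup>2 r\<^sup>\<sigma>\<close> slopes:
  the bad intervals have total length at most \<open>R\<^sup>2 = r\<^bsup>1 - \<sigma>\<^esup> / M\<close>. The number of pairs in a strip of
  width \<open>r\<close> is controlled by the square of the \<open>L\<^sup>2\<close> norm of the projection of \<open>P\<close> in the
  corresponding direction, smoothed at scale \<open>r\<close>. Smoothing at the coarser scale \<open>R\<close> instead changes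
  this norm, on average over all slopes, by a power of \<open>R\<close> only, because the averaged kernels at the
  two scales agree away from the two extreme slopes; this is where \<open>s > 1\<close> enters. At scale \<open>R\<close>
  the trivial bound on the bad intervals suffices, and the resulting powers of \<open>r\<close> are summable.
\<close>

section \<open>Non-crossing segments\<close>

text \<open>An energy bound averaged over slopes says nothing about a small exceptional set of
  slopes, where all the energy might sit. What can be localised is the squared L2 distance between
  the smoothings at scales \<open>r\<close> and \<open>R\<close>: it is nonnegative, so on the bad
  cells it costs at most its integral over all of \<open>[-B, B]\<close>, and only on that full
  range do the averaged kernels cancel. The square root in the choice of \<open>R\<close> comes from
  the remaining term: a sup bound of order n^2 / R on a set of slopes of length R^2 leaves n^2 R.
  What does not cancel is cut at a distance \<tau>: nearer pairs contribute n^2 \<tau>^(s-1);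
  farther ones lie in thin strips of slopes B and -B and contribute n^2 R^(s-1) / \<tau>. Since one
  set \<open>L\<close> has to serve all arcs, the cells of all dyadic lengths at least \<delta> are
  cleaned at once; \<sigma> < 1 makes the losses summable and a large \<open>M\<close> makes their
  sum small. Three discarded families of at most n^2 / 8 ordered pairs each leave at least half of
  all pairs.\<close>

definition slope :: "real \<times> real \<Rightarrow> real \<times> real \<Rightarrow> real" where
  "slope p q = (snd q - snd p) / (fst q - fst p)"

definition height :: "(real \<times> real) \<times> (real \<times> real) \<Rightarrow> real \<Rightarrow> real" where
  "height e x = snd (fst e) + slope (fst e) (snd e) * (x - fst (fst e))"

text \<open>Edges run from left to right. The common abscissa is interior to both, so edges that
  only share an endpoint do not cross, whereas overlapping collinear edges do. An edge crosses
  itself, which is why the absence of crossings is phrased as \<open>crossing e f\<close> implying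
  \<open>e = f\<close>.\<close>

definition crossing ::
    "(real \<times> real) \<times> (real \<times> real) \<Rightarrow> (real \<times> real) \<times> (real \<times> real) \<Rightarrow> bool" where
  "crossing e f \<longleftrightarrow> (\<exists>x. fst (fst e) < x \<and> x < fst (snd e) \<and>
     fst (fst f) < x \<and> x < fst (snd f) \<and> height e x = height f x)"

lemma affine_sign_change:
  fixes a b c d x y :: real
  assumes "x < y" "a + b * x < c + d * x" "c + d * y < a + b * y"
  shows "\<exists>z. x < z \<and> z < y \<and> a + b * z = c + d * z"
proof -
  have "\<exists>z\<ge>x. z \<le> y \<and> (a + b * z) - (c + d * z) = 0"
    by (rule IVT') (use assms in \<open>auto intro!: continuous_intros\<close>)
  then obtain z where z: "x \<le> z" "z \<le> y" "a + b * z = c + d * z" by auto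
  moreover have "z \<noteq> x" "z \<noteq> y" using z assms by auto
  ultimately show ?thesis by (intro exI[of _ z]) auto
qed

lemma finite_has_least_value:
  fixes f :: "'a \<Rightarrow> real"
  assumes "finite S" "S \<noteq> {}"
  obtains a where "a \<in> S" "\<forall>c\<in>S. f a \<le> f c"
proof -
  have "Min (f ` S) \<in> f ` S" using assms by (intro Min_in) auto
  then obtain a where "a \<in> S" "f a = Min (f ` S)" by auto
  moreover have "\<forall>c\<in>S. Min (f ` S) \<le> f c" using assms by simp
  ultimately show ?thesis using that by metis
qed

lemma crossingI:
  assumes "fst (fst e) \<le> x" "x < y" "y \<le> fst (snd e)"
    and "fst (fst f) \<le> x" "y \<le> fst (snd f)"
    and "height e x < height f x" "height f y < height e y"
  shows "crossing e f"
proof -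
  let ?a = "\<lambda>e. snd (fst e) - slope (fst e) (snd e) * fst (fst e)"
  let ?b = "\<lambda>e. slope (fst e) (snd e)"
  have h: "height e z = ?a e + ?b e * z" for e z
    unfolding height_def by (simp add: algebra_simps)
  obtain z where "x < z" "z < y" "height e z = height f z"
    using affine_sign_change[of x y "?a e" "?b e" "?a f" "?b f"] assms unfolding h by blast
  then show ?thesis unfolding crossing_def using assms by (intro exI[of _ z]) auto
qed

lemma crossing_same_left:
  assumes "fst v < fst b" "fst v < fst b'" "slope v b = slope v b'"
  shows "crossing (v, b) (v, b')"
  unfolding crossing_def height_def using assms
  by (intro exI[of _ "(fst v + min (fst b) (fst b')) / 2"]) (auto simp: min_def)

lemma snd_eq_slope: "fst v < fst w \<Longrightarrow> snd w = snd v + slope v w * (fst w - fst v)"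
  by (simp add: slope_def)

text \<open>The wedge between the edges \<open>v b\<close> and \<open>v a\<close>, consecutive in slope at \<open>v\<close>, is charged to
  the first vertex \<open>w\<close> in it. Without crossings no vertex is charged more than twice, which bounds
  the number of edges without Euler's formula.\<close>

definition wedge where
  "wedge P E v b a w \<longleftrightarrow> (v, b) \<in> E \<and> (v, a) \<in> E \<and> slope v b < slope v a \<and>
     (\<forall>c. (v, c) \<in> E \<longrightarrow> slope v b < slope v c \<longrightarrow> slope v a \<le> slope v c) \<and>
     w \<in> P \<and> fst v < fst w \<and> slope v b \<le> slope v w \<and> slope v w \<le> slope v a \<and>
     (\<forall>u\<in>P. fst v < fst u \<and> slope v b \<le> slope v u \<and> slope v u \<le> slope v a \<longrightarrow> fst w \<le> fst u)"

lemma wedge_exists: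
  assumes "finite P" "E \<subseteq> {(p, q). p \<in> P \<and> q \<in> P \<and> fst p < fst q}"
    and "(v, b) \<in> E" "(v, c) \<in> E" "slope v b < slope v c"
  shows "\<exists>a w. wedge P E v b a w"
proof -
  define S where "S = {c. (v, c) \<in> E \<and> slope v b < slope v c}"
  have "S \<subseteq> P" using assms(2) unfolding S_def by auto
  hence "finite S" using assms(1) finite_subset by blast
  moreover have "S \<noteq> {}" using assms(4,5) unfolding S_def by blast
  ultimately obtain a where a: "a \<in> S" "\<forall>c\<in>S. slope v a \<le> slope v c"
    by (rule finite_has_least_value)
  define W where "W = {u\<in>P. fst v < fst u \<and> slope v b \<le> slope v u \<and> slope v u \<le> slope v a}"
  have "finite W" "b \<in> W" using assms a unfolding W_def S_def by auto
  then have "finite W" "W \<noteq> {}" by auto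
  then obtain w where w: "w \<in> W" "\<forall>u\<in>W. fst w \<le> fst u"
    by (rule finite_has_least_value)
  have "wedge P E v b a w"
    using a w assms(3) unfolding wedge_def S_def W_def by blast
  then show ?thesis by blast
qed

text \<open>Suppose that the apex \<open>v'\<close> is not to the left of \<open>v\<close> and
  differs from it. Being closer than \<open>w\<close>, it lies outside the wedge at
  \<open>v\<close>, say below the edge \<open>v b\<close>. The wedge at \<open>v'\<close> contains
  \<open>w\<close>, so its upper edge has to climb through \<open>v b\<close> before it reaches the
  abscissa of \<open>w\<close>. Hypothesis \<open>ty\<close> supplies the strict inequality at that
  abscissa.\<close>

lemma wedge_apex_le:
  assumes E: "E \<subseteq> {(p, q). p \<in> P \<and> q \<in> P \<and> fst p < fst q}"
    and nc: "\<forall>e\<in>E. \<forall>f\<in>E. crossing e f \<longrightarrow> e = f"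
    and w1: "wedge P E v b a w" and w2: "wedge P E v' b' a' w"
    and ty: "slope v w < slope v a \<and> slope v' w < slope v' a' \<or>
             slope v b < slope v w \<and> slope v' b' < slope v' w"
    and le: "fst v \<le> fst v'"
  shows "v = v'"
proof (rule ccontr)
  assume ne: "v \<noteq> v'"
  have mem: "(v, b) \<in> E" "(v, a) \<in> E" "(v', b') \<in> E" "(v', a') \<in> E" "v' \<in> P"
    and lt: "fst v < fst b" "fst v < fst a" "fst v' < fst b'" "fst v' < fst a'"
      "fst v < fst w" "fst v' < fst w"
    using w1 w2 E unfolding wedge_def by auto
  have P: "a \<in> P" "b \<in> P" "a' \<in> P" "b' \<in> P" using mem E by auto
  \<comment> \<open>The far ends of the bounding edges belong to the wedge themselves, so none lies
    to the left of the first vertex \<open>w\<close>. All four edges therefore reach the abscissa of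
    \<open>w\<close>.\<close>
  have fw: "fst w \<le> fst a" "fst w \<le> fst b" "fst w \<le> fst a'" "fst w \<le> fst b'"
    using w1 w2 P lt unfolding wedge_def by auto
  have sw: "snd w = snd v + slope v w * (fst w - fst v)"
    "snd w = snd v' + slope v' w * (fst w - fst v')"
    using snd_eq_slope lt(5,6) by blast+
  have hv': "height (v', c) (fst v') = snd v'" for c by (simp add: height_def)
  have hw: "height (v, b) (fst w) \<le> snd w" "snd w \<le> height (v, a) (fst w)"
    "height (v', b') (fst w) \<le> snd w" "snd w \<le> height (v', a') (fst w)"
  proof -
    have "slope v b \<le> slope v w" "slope v w \<le> slope v a"
      "slope v' b' \<le> slope v' w" "slope v' w \<le> slope v' a'"
      using w1 w2 unfolding wedge_def by blast+
    then have "slope v b * (fst w - fst v) \<le> slope v w * (fst w - fst v)"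
      "slope v w * (fst w - fst v) \<le> slope v a * (fst w - fst v)"
      "slope v' b' * (fst w - fst v') \<le> slope v' w * (fst w - fst v')"
      "slope v' w * (fst w - fst v') \<le> slope v' a' * (fst w - fst v')"
      using lt(5,6) by (simp_all add: mult_right_mono)
    then show "height (v, b) (fst w) \<le> snd w" "snd w \<le> height (v, a) (fst w)"
      "height (v', b') (fst w) \<le> snd w" "snd w \<le> height (v', a') (fst w)"
      using sw by (simp_all add: height_def)
  qed
  have hs: "snd w < height (v, a) (fst w) \<and> snd w < height (v', a') (fst w) \<or>
      height (v, b) (fst w) < snd w \<and> height (v', b') (fst w) < snd w"
    using ty
  proof (elim disjE conjE)
    assume "slope v w < slope v a" "slope v' w < slope v' a'"
    then have "slope v w * (fst w - fst v) < slope v a * (fst w - fst v)"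
      "slope v' w * (fst w - fst v') < slope v' a' * (fst w - fst v')" using lt by auto
    then show ?thesis using sw by (simp add: height_def)
  next
    assume "slope v b < slope v w" "slope v' b' < slope v' w"
    then have "slope v b * (fst w - fst v) < slope v w * (fst w - fst v)"
      "slope v' b' * (fst w - fst v') < slope v' w * (fst w - fst v')" using lt by auto
    then show ?thesis using sw by (simp add: height_def)
  qed
  have out: "snd v' < height (v, b) (fst v') \<or> height (v, a) (fst v') < snd v'"
  proof (cases "fst v = fst v'")
    case True
    then have "snd v \<noteq> snd v'" using ne by (simp add: prod_eq_iff)
    then show ?thesis using True by (auto simp: height_def)
  next
    case False
    then have l: "fst v < fst v'" using le by simp
    have "slope v v' < slope v b \<or> slope v a < slope v v'"
      using w1 l mem lt(6) unfolding wedge_def by force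
    then have "slope v v' * (fst v' - fst v) < slope v b * (fst v' - fst v) \<or>
      slope v a * (fst v' - fst v) < slope v v' * (fst v' - fst v)" using l by auto
    then show ?thesis using snd_eq_slope[OF l] by (auto simp: height_def)
  qed
  then show False
  proof
    assume "snd v' < height (v, b) (fst v')"
    then have "crossing (v', a') (v, b)"
      using hs hw lt fw le hv' by (intro crossingI[of _ "fst v'" "fst w"]) auto
    then show False using nc mem ne by blast
  next
    assume "height (v, a) (fst v') < snd v'"
    then have "crossing (v, a) (v', b')"
      using hs hw lt fw le hv' by (intro crossingI[of _ "fst v'" "fst w"]) auto
    then show False using nc mem ne by blast
  qed
qed

text \<open>Different wedges at one apex meet at most along a common edge. If \<open>w\<close> lay
  in both, it would be on the upper edge of one and on the lower edge of the other, which both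
  alternatives of \<open>ty\<close> exclude.\<close>

lemma wedge_unique:
  assumes E: "E \<subseteq> {(p, q). p \<in> P \<and> q \<in> P \<and> fst p < fst q}"
    and nc: "\<forall>e\<in>E. \<forall>f\<in>E. crossing e f \<longrightarrow> e = f"
    and w1: "wedge P E v b a w" and w2: "wedge P E v' b' a' w"
    and ty: "slope v w < slope v a \<and> slope v' w < slope v' a' \<or>
             slope v b < slope v w \<and> slope v' b' < slope v' w"
  shows "v = v' \<and> b = b'"
proof -
  have v: "v = v'"
    using wedge_apex_le[OF E nc w1 w2 ty] wedge_apex_le[OF E nc w2 w1] ty by (metis linear)
  have "\<not> slope v b < slope v b'" "\<not> slope v b' < slope v b"
    using w1 w2 ty unfolding wedge_def v by fastforce+
  then have "slope v b = slope v b'" by simp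
  moreover have "fst v < fst b" "fst v < fst b'" "(v, b) \<in> E" "(v, b') \<in> E"
    using w1 w2 E unfolding wedge_def v by auto
  ultimately have "(v, b) = (v, b')" using crossing_same_left nc by metis
  then show ?thesis using v by simp
qed

text \<open>Three injections into \<open>P\<close>: edges of greatest slope at their left end
  (\<open>T\<close>) are charged to that end; every other edge bounds a wedge from below and is
  charged to its first vertex, injectively within each of the classes \<open>U\<close> and
  \<open>V\<close>.\<close>

lemma card_noncrossing_le:
  assumes P: "finite P" and E: "E \<subseteq> {(p, q). p \<in> P \<and> q \<in> P \<and> fst p < fst q}"
    and nc: "\<forall>e\<in>E. \<forall>f\<in>E. crossing e f \<longrightarrow> e = f"
  shows "card E \<le> 3 * card P"
proof -
  have "E \<subseteq> P \<times> P" using E by auto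
  then have finE: "finite E" using P finite_subset by blast
  define T where "T = {e\<in>E. \<forall>c. (fst e, c) \<in> E \<longrightarrow> slope (fst e) c \<le> slope (fst e) (snd e)}"
  have injT: "inj_on fst T"
  proof (rule inj_onI)
    fix e f assume ef: "e \<in> T" "f \<in> T" "fst e = fst f"
    obtain v b b' where e: "e = (v, b)" "f = (v, b')" using ef(3) by (cases e; cases f) auto
    have mem: "(v, b) \<in> E" "(v, b') \<in> E" using ef unfolding T_def e by auto
    then have "slope v b' \<le> slope v b" "slope v b \<le> slope v b'"
      using ef(1,2) unfolding T_def e by (simp_all del: split_paired_All)
    then have "slope v b = slope v b'" by (rule order_antisym[rotated])
    moreover note mem
    moreover have "fst v < fst b" "fst v < fst b'" using mem E by auto
    ultimately show "e = f" using nc crossing_same_left unfolding e by blast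
  qed
  have "fst ` T \<subseteq> P" using E unfolding T_def by auto
  then have cT: "card T \<le> card P" using injT P card_inj_on_le by blast
  have "\<forall>e\<in>E - T. \<exists>x. wedge P E (fst e) (snd e) (fst x) (snd x)"
  proof
    fix e assume e: "e \<in> E - T"
    then obtain c where "(fst e, c) \<in> E" "slope (fst e) (snd e) < slope (fst e) c"
      unfolding T_def by auto
    moreover have "(fst e, snd e) \<in> E" using e by simp
    ultimately show "\<exists>x. wedge P E (fst e) (snd e) (fst x) (snd x)"
      using wedge_exists[OF P E] by (metis fst_conv snd_conv)
  qed
  then obtain g where g: "\<And>e. e \<in> E - T \<Longrightarrow> wedge P E (fst e) (snd e) (fst (g e)) (snd (g e))"
    by metis
  define h where "h e = snd (g e)" for e
  \<comment> \<open>The split serves the two alternatives of \<open>wedge_unique\<close>: in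
    \<open>U\<close> the charged vertex is strictly below the upper edge, while in \<open>V\<close>
    it is on the upper edge and hence strictly above the lower one.\<close>
  define U where "U = {e\<in>E - T. slope (fst e) (h e) < slope (fst e) (fst (g e))}"
  define V where "V = E - T - U"
  have "inj_on h U"
  proof (rule inj_onI)
    fix e f assume ef: "e \<in> U" "f \<in> U" "h e = h f"
    have we: "wedge P E (fst e) (snd e) (fst (g e)) (h e)"
      and wf: "wedge P E (fst f) (snd f) (fst (g f)) (h e)"
      using g[of e] g[of f] ef(1,2) ef(3)[unfolded h_def] unfolding h_def U_def by simp_all
    have "slope (fst e) (h e) < slope (fst e) (fst (g e))"
      "slope (fst f) (h e) < slope (fst f) (fst (g f))"
      using ef unfolding U_def by simp_all
    then show "e = f" using wedge_unique[OF E nc we wf] by (simp add: prod_eq_iff)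
  qed
  moreover have "inj_on h V"
  proof (rule inj_onI)
    fix e f assume ef: "e \<in> V" "f \<in> V" "h e = h f"
    have st: "slope (fst e) (snd e) < slope (fst e) (h e)" if "e \<in> V" for e
      using g[of e] that unfolding V_def U_def wedge_def h_def by auto
    have we: "wedge P E (fst e) (snd e) (fst (g e)) (h e)"
      and wf: "wedge P E (fst f) (snd f) (fst (g f)) (h e)"
      using g[of e] g[of f] ef(1,2) ef(3)[unfolded h_def] unfolding h_def V_def by simp_all
    show "e = f"
      using wedge_unique[OF E nc we wf] st[OF ef(1)] st[OF ef(2)] ef(3) by (simp add: prod_eq_iff)
  qed
  moreover have "h ` U \<subseteq> P" "h ` V \<subseteq> P"
    using g unfolding U_def V_def wedge_def h_def by auto
  ultimately have c: "card U \<le> card P" "card V \<le> card P" using P card_inj_on_le by blast+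
  have "E = T \<union> (U \<union> V)" unfolding V_def U_def T_def by auto
  then have "card E \<le> card T + (card U + card V)"
    by (metis card_Un_le add_left_mono order_trans)
  then show ?thesis using c cT by simp
qed

section \<open>The crossing inequality\<close>

text \<open>Random sampling by counting: keeping the points of colour 0 in a uniform colouring
  retains each point independently with probability 1 / k, so a set \<open>A\<close> survives in the
  proportion k^(-|A|) of all colourings.\<close>

lemma card_colourings:
  assumes "finite P" "A \<subseteq> P" "0 < k"
  shows "card {c \<in> P \<rightarrow>\<^sub>E {..<k::nat}. \<forall>p\<in>A. c p = 0} * k ^ card A = k ^ card P"
proof -
  have "{c \<in> P \<rightarrow>\<^sub>E {..<k}. \<forall>p\<in>A. c p = 0} = (\<Pi>\<^sub>E p\<in>P. if p \<in> A then {0} else {..<k})"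
    (is "?L = ?R")
  proof (intro subset_antisym subsetI)
    fix c assume "c \<in> ?L"
    then show "c \<in> ?R" by (simp add: PiE_iff)
  next
    fix c assume c: "c \<in> ?R"
    have "c p < k" if "p \<in> P" for p
      using PiE_mem[OF c that] assms(3) by (cases "p \<in> A") auto
    moreover have "c p = 0" if "p \<in> A" for p
      using PiE_mem[OF c, of p] assms(2) that by auto
    ultimately show "c \<in> ?L" using c by (simp add: PiE_iff)
  qed
  then have "card {c \<in> P \<rightarrow>\<^sub>E {..<k}. \<forall>p\<in>A. c p = 0} = (\<Prod>p\<in>P. if p \<in> A then 1 else k)"
    using assms(1) by (simp add: card_PiE if_distrib cong: if_cong)
  also have "\<dots> = (\<Prod>p\<in>P - A. k)"
    using assms by (intro prod.mono_neutral_cong_right) auto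
  also have "\<dots> = k ^ card (P - A)" by simp
  finally show ?thesis
    using assms card_mono[of P A] by (simp add: card_Diff_subset finite_subset flip: power_add)
qed

text \<open>The expected number of surviving configurations of \<open>d\<close> points each, by
  double counting. It is used with \<open>d\<close> = 1, 2 and 4, for points, edges and
  crossings.\<close>

lemma sum_card_colourings:
  assumes "finite P" "finite Z" "\<And>z. z \<in> Z \<Longrightarrow> A z \<subseteq> P \<and> card (A z) = d" "0 < k"
  shows "(\<Sum>c \<in> P \<rightarrow>\<^sub>E {..<k::nat}. real (card {z\<in>Z. \<forall>p\<in>A z. c p = 0}))
    = real (card Z) * real k ^ card P / real k ^ d"
proof -
  let ?F = "P \<rightarrow>\<^sub>E {..<k}"
  have fin: "finite ?F" using assms(1) by (simp add: finite_PiE)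
  have "(\<Sum>c \<in> ?F. card {z\<in>Z. \<forall>p\<in>A z. c p = 0})
      = (\<Sum>z\<in>Z. card {c \<in> ?F. \<forall>p\<in>A z. c p = 0})"
    using fin assms(2) by (intro sum_multicount_gen) auto
  then have "(\<Sum>c \<in> ?F. real (card {z\<in>Z. \<forall>p\<in>A z. c p = 0}))
      = (\<Sum>z\<in>Z. real (card {c \<in> ?F. \<forall>p\<in>A z. c p = 0}))"
    by (simp only: of_nat_sum[symmetric])
  also have "\<dots> = (\<Sum>z\<in>Z. real k ^ card P / real k ^ d)"
  proof (rule sum.cong)
    fix z assume "z \<in> Z"
    then have "card {c \<in> ?F. \<forall>p\<in>A z. c p = 0} * k ^ d = k ^ card P"
      using card_colourings[of P "A z" k] assms by auto
    then have "real (card {c \<in> ?F. \<forall>p\<in>A z. c p = 0} * k ^ d) = real (k ^ card P)"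
      by (rule arg_cong)
    then have "real (card {c \<in> ?F. \<forall>p\<in>A z. c p = 0}) * real k ^ d = real k ^ card P"
      by (simp only: of_nat_mult of_nat_power)
    then show "real (card {c \<in> ?F. \<forall>p\<in>A z. c p = 0}) = real k ^ card P / real k ^ d"
      using assms(4) by (simp add: field_simps)
  qed simp
  finally show ?thesis by simp
qed

text \<open>The linear bound for drawings without crossings is applied to the sample and averaged:
  with e edges, n points and x crossings, e / k^2 is at most 3 n / k + x / k^4. Hypothesis
  \<open>dis\<close> gives each crossing four distinct endpoints, so that it survives with
  probability exactly k^(-4).\<close>

lemma crossing_inequality:
  fixes k :: nat
  assumes P: "finite P" and E: "E \<subseteq> {(p, q). p \<in> P \<and> q \<in> P \<and> fst p < fst q}"
    and X: "X = {x \<in> E \<times> E. fst x \<noteq> snd x \<and> crossing (fst x) (snd x)}"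
    and dis: "\<And>e f. (e, f) \<in> X \<Longrightarrow> card {fst e, snd e, fst f, snd f} = 4"
    and k: "0 < k"
  shows "real k ^ 2 * card E \<le> 3 * card P * real k ^ 3 + card X"
proof -
  let ?F = "P \<rightarrow>\<^sub>E {..<k}"
  define A where "A e = {fst e, snd e}" for e :: "(real \<times> real) \<times> (real \<times> real)"
  define B where "B x = A (fst x) \<union> A (snd x)" for x
  define Ec where "Ec c = {e\<in>E. \<forall>p\<in>A e. c p = 0}" for c :: "real \<times> real \<Rightarrow> nat"
  define Xc where "Xc c = {x\<in>X. \<forall>p\<in>B x. c p = 0}" for c :: "real \<times> real \<Rightarrow> nat"
  define Pc where "Pc c = {p\<in>P. \<forall>p\<in>{p}. c p = 0}" for c :: "real \<times> real \<Rightarrow> nat"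
  have "E \<subseteq> P \<times> P" using E by auto
  then have finE: "finite E" using P finite_subset by blast
  then have finX: "finite X" unfolding X by simp
  have pt: "card (Ec c) \<le> 3 * card (Pc c) + card (Xc c)" for c
  proof -
    \<comment> \<open>Deleting one edge of every surviving crossing leaves a drawing without
      crossings on the sampled points.\<close>
    define D where "D = Ec c - fst ` Xc c"
    have "card D \<le> 3 * card (Pc c)"
    proof (rule card_noncrossing_le)
      show "finite (Pc c)" using P unfolding Pc_def by simp
      show "D \<subseteq> {(p, q). p \<in> Pc c \<and> q \<in> Pc c \<and> fst p < fst q}"
        using E unfolding D_def Ec_def Pc_def A_def by auto
      show "\<forall>e\<in>D. \<forall>f\<in>D. crossing e f \<longrightarrow> e = f"
      proof (intro ballI impI, rule ccontr)
        fix e f assume "e \<in> D" "f \<in> D" "crossing e f" "e \<noteq> f"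
        then have "(e, f) \<in> Xc c" unfolding D_def Ec_def Xc_def X B_def by auto
        then show False using \<open>e \<in> D\<close> unfolding D_def by force
      qed
    qed
    moreover have "card (fst ` Xc c) \<le> card (Xc c)"
      using finX unfolding Xc_def by (intro card_image_le) auto
    moreover have "card (Ec c) \<le> card (D \<union> fst ` Xc c)"
      using finE finX unfolding D_def Ec_def Xc_def by (intro card_mono) auto
    ultimately show ?thesis using card_Un_le[of D "fst ` Xc c"] by linarith
  qed
  have "(\<Sum>c\<in>?F. real (card (Ec c))) \<le> (\<Sum>c\<in>?F. 3 * real (card (Pc c)) + real (card (Xc c)))"
  proof (rule sum_mono)
    fix c
    show "real (card (Ec c)) \<le> 3 * real (card (Pc c)) + real (card (Xc c))"
      using pt[of c] by linarith
  qed
  also have "\<dots> = 3 * (\<Sum>c\<in>?F. real (card (Pc c))) + (\<Sum>c\<in>?F. real (card (Xc c)))"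
    by (simp add: sum.distrib sum_distrib_left)
  finally have le: "(\<Sum>c\<in>?F. real (card (Ec c)))
    \<le> 3 * (\<Sum>c\<in>?F. real (card (Pc c))) + (\<Sum>c\<in>?F. real (card (Xc c)))" .
  have 1: "(\<Sum>c\<in>?F. real (card (Ec c))) = card E * real k ^ card P / real k ^ 2"
    unfolding Ec_def by (rule sum_card_colourings) (use P finE E k in \<open>auto simp: A_def card_insert_if\<close>)
  have 2: "(\<Sum>c\<in>?F. real (card (Pc c))) = card P * real k ^ card P / real k ^ 1"
    unfolding Pc_def by (rule sum_card_colourings) (use P k in auto)
  have 3: "(\<Sum>c\<in>?F. real (card (Xc c))) = card X * real k ^ card P / real k ^ 4"
    unfolding Xc_def
  proof (rule sum_card_colourings)
    fix x assume x: "x \<in> X"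
    have "B x = {fst (fst x), snd (fst x), fst (snd x), snd (snd x)}"
      unfolding B_def A_def by auto
    then have "card (B x) = 4" using dis[of "fst x" "snd x"] x by simp
    moreover have "B x \<subseteq> P" using x E unfolding X B_def A_def by auto
    ultimately show "B x \<subseteq> P \<and> card (B x) = 4" by simp
  qed (use P finX k in auto)
  have "card E * real k ^ card P / real k ^ 2 * (real k ^ 4 / real k ^ card P)
    \<le> (3 * (card P * real k ^ card P / real k ^ 1) + card X * real k ^ card P / real k ^ 4)
        * (real k ^ 4 / real k ^ card P)"
    using le unfolding 1 2 3 by (intro mult_right_mono) auto
  moreover have "card E * real k ^ card P / real k ^ 2 * (real k ^ 4 / real k ^ card P)
    = real k ^ 2 * card E"
    using k by (simp add: field_simps power4_eq_xxxx power2_eq_square)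
  moreover have "(3 * (card P * real k ^ card P / real k ^ 1) + card X * real k ^ card P / real k ^ 4)
        * (real k ^ 4 / real k ^ card P) = 3 * card P * real k ^ 3 + card X"
    using k by (simp add: field_simps power4_eq_xxxx power3_eq_cube)
  ultimately show ?thesis by simp
qed

section \<open>Rich lines\<close>

text \<open>A line is encoded as the pair of its slope and its intercept. This leaves out vertical
  lines and makes equality of lines equality of pairs.\<close>

definition points_on :: "(real \<times> real) set \<Rightarrow> real \<times> real \<Rightarrow> (real \<times> real) set" where
  "points_on P l = {p \<in> P. snd p = fst l * fst p + snd l}"

definition line_of :: "real \<times> real \<Rightarrow> real \<times> real \<Rightarrow> real \<times> real" where
  "line_of p q = (slope p q, snd p - slope p q * fst p)"

definition consecutive ::
    "(real \<times> real) set \<Rightarrow> real \<times> real \<Rightarrow> ((real \<times> real) \<times> (real \<times> real)) set" where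
  "consecutive P l = {(p, q). p \<in> points_on P l \<and> q \<in> points_on P l \<and> fst p < fst q \<and>
     (\<forall>r\<in>points_on P l. \<not> (fst p < fst r \<and> fst r < fst q))}"

lemma line_eqI:
  fixes l l' :: "real \<times> real"
  assumes "fst l * x + snd l = fst l' * x + snd l'" "fst l * y + snd l = fst l' * y + snd l'" "x \<noteq> y"
  shows "l = l'"
proof -
  have "(fst l - fst l') * (x - y) = 0" using assms by (simp add: algebra_simps)
  then have "fst l = fst l'" using assms(3) by simp
  then show ?thesis using assms by (simp add: prod_eq_iff)
qed

lemma points_on_line_of:
  "fst p \<noteq> fst q \<Longrightarrow> p \<in> P \<Longrightarrow> q \<in> P \<Longrightarrow> p \<in> points_on P (line_of p q) \<and> q \<in> points_on P (line_of p q)"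
  by (auto simp: points_on_def line_of_def slope_def divide_simps) (simp add: algebra_simps)

lemma line_of_points_on:
  assumes "p \<in> points_on P l" "q \<in> points_on P l" "fst p \<noteq> fst q"
  shows "line_of p q = l"
proof -
  have "p \<in> P" "q \<in> P" using assms by (auto simp: points_on_def)
  then have "p \<in> points_on P (line_of p q)" "q \<in> points_on P (line_of p q)"
    using points_on_line_of assms(3) by blast+
  then show ?thesis
    using assms by (intro line_eqI[of _ "fst p" _ "fst q"]) (auto simp: points_on_def)
qed

lemma points_on_eqI: "p \<in> points_on P l \<Longrightarrow> q \<in> points_on P l \<Longrightarrow> fst p = fst q \<Longrightarrow> p = q"
  by (auto simp: points_on_def prod_eq_iff)

lemma height_consecutive:
  assumes "e \<in> consecutive P l" shows "height e x = fst l * x + snd l"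
proof -
  have "line_of (fst e) (snd e) = l"
    using assms by (intro line_of_points_on) (auto simp: consecutive_def)
  then have "fst l = slope (fst e) (snd e)" "snd l = snd (fst e) - slope (fst e) (snd e) * fst (fst e)"
    by (auto simp: line_of_def)
  then show ?thesis by (simp add: height_def algebra_simps)
qed

lemma consecutive_overlap:
  assumes "e \<in> consecutive P l" "f \<in> consecutive P l"
    and "fst (fst e) < x" "x < fst (snd e)" "fst (fst f) < x" "x < fst (snd f)"
  shows "e = f"
proof -
  have "\<not> fst (fst e) < fst (fst f)" "\<not> fst (fst f) < fst (fst e)"
    "\<not> fst (snd e) < fst (snd f)" "\<not> fst (snd f) < fst (snd e)"
    using assms unfolding consecutive_def by fastforce+
  then have "fst (fst e) = fst (fst f)" "fst (snd e) = fst (snd f)" by auto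
  then show ?thesis using assms points_on_eqI unfolding consecutive_def
    by (auto simp: prod_eq_iff points_on_def)
qed

text \<open>Two different lines meet at most once. The crossing is interior to both segments, so a
  shared endpoint would be a second common point.\<close>

lemma crossing_consecutive:
  assumes e: "e \<in> consecutive P l" and f: "f \<in> consecutive P l'" and "crossing e f" "e \<noteq> f"
  shows "l \<noteq> l'" "card {fst e, snd e, fst f, snd f} = 4"
proof -
  obtain x where x: "fst (fst e) < x" "x < fst (snd e)" "fst (fst f) < x" "x < fst (snd f)"
    and hx: "height e x = height f x" using assms(3) unfolding crossing_def by blast
  show ne: "l \<noteq> l'" using consecutive_overlap[OF e _ x(1,2)] f x assms(4) by blast
  have dj: "u \<noteq> v" if "u \<in> {fst e, snd e}" "v \<in> {fst f, snd f}" for u v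
  proof
    assume "u = v"
    have "fst l * x + snd l = fst l' * x + snd l'"
      using hx height_consecutive e f by metis
    moreover have "fst l * fst u + snd l = fst l' * fst u + snd l'"
      using that e f \<open>u = v\<close> unfolding consecutive_def points_on_def by auto
    moreover have "fst u \<noteq> x" using that x by auto
    ultimately show False using ne line_eqI by blast
  qed
  have "fst e \<noteq> snd e" "fst f \<noteq> snd f" using e f unfolding consecutive_def by auto
  moreover have "fst e \<noteq> fst f" "fst e \<noteq> snd f" "snd e \<noteq> fst f" "snd e \<noteq> snd f"
    using dj by blast+
  ultimately show "card {fst e, snd e, fst f, snd f} = 4" by (simp add: card_insert_if)
qed

text \<open>Every point on the line except the rightmost one has a successor, its nearest neighbour
  to the right.\<close>

lemma card_consecutive_ge:
  assumes "finite P" shows "card (points_on P l) \<le> card (consecutive P l) + 1"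
proof (cases "points_on P l = {}")
  case False
  have fin: "finite (points_on P l)" using assms unfolding points_on_def by simp
  \<comment> \<open>Minimising the negated abscissa selects the rightmost point.\<close>
  then obtain m where m: "m \<in> points_on P l" "\<forall>p\<in>points_on P l. - fst m \<le> - fst p"
    using False by (rule finite_has_least_value)
  have "points_on P l - {m} \<subseteq> fst ` consecutive P l"
  proof
    fix p assume p: "p \<in> points_on P l - {m}"
    define S where "S = {q \<in> points_on P l. fst p < fst q}"
    have "fst p \<le> fst m" "fst p \<noteq> fst m" using p m points_on_eqI[of p P l m] by auto
    then have "m \<in> S" "finite S" using m fin unfolding S_def by auto
    then have "finite S" "S \<noteq> {}" by auto
    then obtain q where q: "q \<in> S" "\<forall>r\<in>S. fst q \<le> fst r"
      by (rule finite_has_least_value)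
    then have "q \<in> points_on P l" "fst p < fst q"
      unfolding S_def by auto
    moreover have "\<not> (fst p < fst r \<and> fst r < fst q)" if "r \<in> points_on P l" for r
    proof
      assume "fst p < fst r \<and> fst r < fst q"
      then have "r \<in> S" "fst r < fst q" using that unfolding S_def by auto
      then show False using q(2) by auto
    qed
    ultimately have "(p, q) \<in> consecutive P l" using p unfolding consecutive_def by blast
    then show "p \<in> fst ` consecutive P l" by force
  qed
  moreover have finc: "finite (consecutive P l)"
    by (rule finite_subset[of _ "points_on P l \<times> points_on P l"])
       (use fin in \<open>auto simp: consecutive_def\<close>)
  ultimately have "card (points_on P l - {m}) \<le> card (consecutive P l)"
    by (meson card_image_le card_mono finite_imageI order_trans)
  then show ?thesis using m fin by simp
qed simp

text \<open>Szekely's argument: the consecutive points on the lines form a drawing in which every pair of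
  lines contributes at most one crossing.\<close>

lemma rich_lines_sampling:
  fixes \<kappa> :: nat
  assumes P: "finite P" and L: "finite L" "\<And>l. l \<in> L \<Longrightarrow> \<kappa> \<le> card (points_on P l)"
  shows "\<exists>m. real (card L) * (real \<kappa> - 1) \<le> real m \<and>
    (\<forall>k>0. real k ^ 2 * real m \<le> 3 * card P * real k ^ 3 + real (card L) ^ 2)"
proof -
  define E where "E = (\<Union>l\<in>L. consecutive P l)"
  have finc: "finite (consecutive P l)" for l
    by (rule finite_subset[of _ "P \<times> P"]) (use P in \<open>auto simp: consecutive_def points_on_def\<close>)
  \<comment> \<open>An edge determines its line, so different lines have disjoint edge sets and the
    edge counts add up.\<close>
  define g where "g e = line_of (fst e) (snd e)" for e
  have g: "g e = l" if "e \<in> consecutive P l" for e l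
    using that unfolding g_def by (intro line_of_points_on) (auto simp: consecutive_def)
  have "card E = (\<Sum>l\<in>L. card (consecutive P l))"
    unfolding E_def using L(1) finc g by (intro card_UN_disjoint) blast+
  then have "real (card E) = (\<Sum>l\<in>L. real (card (consecutive P l)))" by simp
  also have "\<dots> \<ge> (\<Sum>l\<in>L. real \<kappa> - 1)"
  proof (rule sum_mono)
    fix l assume "l \<in> L"
    then show "real \<kappa> - 1 \<le> real (card (consecutive P l))"
      using card_consecutive_ge[OF P, of l] L(2)[of l] by linarith
  qed
  finally have cE: "real (card L) * (real \<kappa> - 1) \<le> real (card E)" by simp
  define X where "X = {x \<in> E \<times> E. fst x \<noteq> snd x \<and> crossing (fst x) (snd x)}"
  have inE: "g e \<in> L \<and> e \<in> consecutive P (g e)" if e: "e \<in> E" for e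
  proof -
    obtain l where "l \<in> L" "e \<in> consecutive P l" using e unfolding E_def by blast
    then show ?thesis using g by simp
  qed
  have X4: "card {fst e, snd e, fst f, snd f} = 4" if "(e, f) \<in> X" for e f
    using that inE crossing_consecutive[of e P "g e" f "g f"] unfolding X_def by auto
  have "inj_on (\<lambda>x. (g (fst x), g (snd x))) X"
  proof (rule inj_onI)
    fix x y assume xy: "x \<in> X" "y \<in> X" "(g (fst x), g (snd x)) = (g (fst y), g (snd y))"
    obtain e f e' f' where ef: "x = (e, f)" "y = (e', f')" by (cases x; cases y)
    have mem: "e \<in> consecutive P (g e)" "f \<in> consecutive P (g f)"
      "e' \<in> consecutive P (g e)" "f' \<in> consecutive P (g f)"
      using xy inE[of e] inE[of f] inE[of e'] inE[of f'] unfolding X_def ef by auto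
    have ne: "g e \<noteq> g f"
      using crossing_consecutive(1)[OF mem(1,2)] xy(1) unfolding X_def ef by auto
    obtain u where u: "fst (fst e) < u" "u < fst (snd e)" "fst (fst f) < u" "u < fst (snd f)"
      "height e u = height f u" using xy(1) unfolding X_def ef crossing_def by auto
    obtain v where v: "fst (fst e') < v" "v < fst (snd e')" "fst (fst f') < v" "v < fst (snd f')"
      "height e' v = height f' v" using xy(2) unfolding X_def ef crossing_def by auto
    \<comment> \<open>Both crossings lie on the same two distinct lines, which share only one point.
      Equal abscissae then identify the edges on each line.\<close>
    have "u = v"
      using line_eqI[of "g e" u "g f" v] ne u(5) v(5) height_consecutive mem by metis
    then have "e = e'" "f = f'"
      using consecutive_overlap[OF mem(1,3) u(1,2)] consecutive_overlap[OF mem(2,4) u(3,4)] v by auto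
    then show "x = y" by (simp add: ef)
  qed
  moreover have "(\<lambda>x. (g (fst x), g (snd x))) ` X \<subseteq> L \<times> L" using inE unfolding X_def by auto
  ultimately have "card X \<le> card (L \<times> L)" using L(1) by (intro card_inj_on_le) auto
  then have cX: "real (card X) \<le> real (card L) ^ 2"
    by (simp add: card_cartesian_product power2_eq_square flip: of_nat_mult)
  have Esub: "E \<subseteq> {(p, q). p \<in> P \<and> q \<in> P \<and> fst p < fst q}"
    unfolding E_def consecutive_def points_on_def by auto
  have "real k ^ 2 * real (card E) \<le> 3 * card P * real k ^ 3 + real (card L) ^ 2" if "0 < k" for k :: nat
    using crossing_inequality[OF P Esub X_def X4 that] cX by linarith
  with cE show ?thesis by blast
qed

text \<open>With \<open>m\<close> edges there are two regimes. If \<open>m\<close> is at most 6 n,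
  the bound m >= N \<kappa> / 2 already gives the term in n / \<kappa>. Otherwise sampling gives m^3
  <= 288 n^2 N^2, and inserting m >= N \<kappa> / 2 produces 2304 = 8 * 288.\<close>

lemma card_rich_lines_le:
  fixes \<kappa> :: nat
  assumes P: "finite P" and L: "finite L" "\<And>l. l \<in> L \<Longrightarrow> \<kappa> \<le> card (points_on P l)"
    and \<kappa>: "2 \<le> \<kappa>"
  shows "real (card L) \<le> 2304 * real (card P) ^ 2 / real \<kappa> ^ 3 + 12 * real (card P) / real \<kappa>"
proof (cases "L = {}")
  case False
  define n where "n = real (card P)"
  define N where "N = real (card L)"
  have N: "N > 0" using False L(1) unfolding N_def by (simp add: card_gt_0_iff)
  obtain l where l: "l \<in> L" using False by blast
  have "\<kappa> \<le> card (points_on P l)" using L l by blast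
  also have "\<dots> \<le> card P" using P unfolding points_on_def by (intro card_mono) auto
  finally have n: "n \<ge> 2" using \<kappa> unfolding n_def by simp
  obtain m :: nat where m: "N * (real \<kappa> - 1) \<le> real m"
    and ci: "\<And>k::nat. k > 0 \<Longrightarrow> real k ^ 2 * real m \<le> 3 * n * real k ^ 3 + N ^ 2"
    using rich_lines_sampling[OF P L] unfolding N_def n_def by auto
  have "N * (real \<kappa> / 2) \<le> N * (real \<kappa> - 1)" using N \<kappa> by (intro mult_left_mono) auto
  with m have m2: "N * real \<kappa> / 2 \<le> real m" by simp
  have \<kappa>0: "real \<kappa> > 0" using \<kappa> by simp
  show ?thesis
  proof (cases "real m \<le> 6 * n")
    case True
    then have "N * real \<kappa> \<le> 12 * n" using m2 by simp
    then have "N \<le> 12 * n / real \<kappa>" using \<kappa>0 by (simp add: field_simps)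
    moreover have "2304 * n ^ 2 / real \<kappa> ^ 3 \<ge> 0" by simp
    ultimately show ?thesis unfolding N_def n_def by linarith
  next
    case False
    \<comment> \<open>The largest integer for which the vertex term 3 n k^3 is at most half of k^2 m
      and can be absorbed. It is positive in this regime.\<close>
    define k where "k = nat \<lfloor>real m / (6 * n)\<rfloor>"
    have "real m / (6 * n) \<ge> 1" using False n by (simp add: field_simps)
    then have k1: "k \<ge> 1" and k2: "real k \<le> real m / (6 * n)" and "real m / (6 * n) < real k + 1"
      unfolding k_def by linarith+
    then have k3: "real m / (6 * n) < 2 * real k" by linarith
    have k2': "real k * (6 * n) \<le> real m" and k3': "real m \<le> 12 * n * real k"
      using k2 k3 n by (simp_all add: field_simps)
    have "3 * n * real k ^ 3 = real k ^ 2 * (real k * (6 * n)) / 2"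
      by (simp add: power2_eq_square power3_eq_cube)
    also have "\<dots> \<le> real k ^ 2 * real m / 2" using mult_left_mono[OF k2' zero_le_power2[of "real k"]] by linarith
    finally have "real k ^ 2 * real m \<le> 2 * N ^ 2" using ci[of k] k1 by linarith
    have "real m ^ 2 \<le> (12 * n * real k) ^ 2" using k3' by (intro power_mono) auto
    then have "real m ^ 2 * real m \<le> (12 * n * real k) ^ 2 * real m" by (rule mult_right_mono) simp
    also have "\<dots> = 144 * n ^ 2 * (real k ^ 2 * real m)" by (simp add: power_mult_distrib)
    also have "\<dots> \<le> 144 * n ^ 2 * (2 * N ^ 2)"
      using \<open>real k ^ 2 * real m \<le> 2 * N ^ 2\<close> by (intro mult_left_mono) auto
    finally have "real m ^ 3 \<le> 288 * n ^ 2 * N ^ 2" by (simp add: power2_eq_square power3_eq_cube)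
    moreover have "(N * real \<kappa> / 2) ^ 3 \<le> real m ^ 3" using m2 N \<kappa>0 by (intro power_mono) auto
    moreover have "(N * real \<kappa> / 2) ^ 3 = N ^ 2 * (N * real \<kappa> ^ 3) / 8"
      by (simp add: power_mult_distrib power_divide power2_eq_square power3_eq_cube)
    moreover have "288 * n ^ 2 * N ^ 2 * 8 = N ^ 2 * (2304 * n ^ 2)" by simp
    ultimately have "N ^ 2 * (N * real \<kappa> ^ 3) \<le> N ^ 2 * (2304 * n ^ 2)"
      by linarith
    then have "N * real \<kappa> ^ 3 \<le> 2304 * n ^ 2" using N by simp
    then have "N \<le> 2304 * n ^ 2 / real \<kappa> ^ 3" using \<kappa>0 by (simp add: field_simps)
    moreover have "12 * n / real \<kappa> \<ge> 0" using n \<kappa>0 by simp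
    ultimately show ?thesis unfolding N_def n_def by linarith
  qed
qed simp

section \<open>Dyadic sums and pairs of points on rich lines\<close>

lemma sum_half_powers_le:
  assumes "finite J" "\<And>j. j \<in> J \<Longrightarrow> j0 \<le> j"
  shows "(\<Sum>j\<in>J. (1/2::real) ^ j) \<le> 2 * (1/2) ^ j0"
proof -
  have "(\<Sum>j\<in>J. (1/2::real) ^ j) \<le> (\<Sum>j\<in>{j0..<Suc (Max J) + j0}. (1/2) ^ j)"
    using assms by (intro sum_mono2) (auto simp: less_Suc_eq_le trans_le_add1)
  also have "\<dots> = (\<Sum>j<Suc (Max J). (1/2) ^ (j + j0))"
    using sum.shift_bounds_nat_ivl[of "\<lambda>j. (1/2::real) ^ j" 0 j0 "Suc (Max J)"]
    by (simp add: atLeast0LessThan)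
  also have "\<dots> = (1/2) ^ j0 * (\<Sum>j<Suc (Max J). (1/2) ^ j)"
    by (simp only: power_add sum_distrib_left mult.commute)
  also have "(\<Sum>j<Suc (Max J). (1/2::real) ^ j) \<le> 2"
    by (subst sum_gp_strict) simp
  finally show ?thesis by (simp add: mult.commute)
qed

lemma sum_powers_2_le:
  fixes m :: real
  assumes "finite J" "\<And>j. j \<in> J \<Longrightarrow> 2 ^ j \<le> m" "0 \<le> m"
  shows "(\<Sum>j\<in>J. (2::real) ^ j) \<le> 2 * m"
proof (cases "J = {}")
  case False
  have "(\<Sum>j\<in>J. (2::real) ^ j) \<le> (\<Sum>j<Suc (Max J). 2 ^ j)"
    using assms by (intro sum_mono2) (auto simp: less_Suc_eq_le)
  also have "\<dots> \<le> 2 * 2 ^ Max J" by (subst sum_gp_strict) simp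
  also have "\<dots> \<le> 2 * m" using assms False Max_in by (intro mult_left_mono) auto
  finally show ?thesis .
qed (use assms in simp)

lemma dyadic_exponent:
  fixes c :: nat
  assumes "1 \<le> c" obtains j where "2 ^ j \<le> c" "c < 2 ^ Suc j"
proof -
  define j where "j = (LEAST j. c < 2 ^ Suc j)"
  have "c < 2 ^ c" by simp
  then have "c < 2 ^ Suc c" unfolding power_Suc by linarith
  then have 1: "c < 2 ^ Suc j" unfolding j_def by (rule LeastI)
  have "2 ^ j \<le> c"
  proof (cases j)
    case (Suc i)
    then have "i < j" by simp
    then have "\<not> c < 2 ^ Suc i" unfolding j_def by (rule not_less_Least)
    then show ?thesis using Suc by simp
  qed (use assms in simp)
  then show ?thesis using 1 that by blast
qed

text \<open>Lines are grouped by 2^j <= number of points < 2^(j+1); each carries at most 4^(j+1)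
  ordered pairs, so \<open>card_rich_lines_le\<close> bounds a group by multiples of n^2 / 2^j and n
  2^j. The first sum is governed by the smallest exponent \<open>j0\<close>, the second by the
  largest, where 2^j is at most the maximal number \<open>m\<close> of points on a line.\<close>

lemma card_pairs_on_rich_lines_le:
  fixes m B :: real
  assumes P: "finite P" and j0: "1 \<le> j0" and m: "0 \<le> m"
    and L: "\<And>l. \<bar>fst l\<bar> \<le> B \<Longrightarrow> card (points_on P l) \<le> m"
  shows "card {x \<in> P \<times> P. fst (fst x) \<noteq> fst (snd x) \<and> \<bar>slope (fst x) (snd x)\<bar> \<le> B \<and>
       2 ^ j0 \<le> card (points_on P (line_of (fst x) (snd x)))}
    \<le> 18432 * real (card P) ^ 2 / 2 ^ j0 + 96 * real (card P) * m"
proof -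
  define n where "n = real (card P)"
  define Z where "Z = {x \<in> P \<times> P. fst (fst x) \<noteq> fst (snd x) \<and> \<bar>slope (fst x) (snd x)\<bar> \<le> B}"
  define R where "R = {x \<in> Z. 2 ^ j0 \<le> card (points_on P (line_of (fst x) (snd x)))}"
  define A where "A = (\<lambda>x. line_of (fst x) (snd x)) ` Z"
  define D where "D j = {l \<in> A. 2 ^ j \<le> card (points_on P l) \<and> card (points_on P l) < 2 ^ Suc j}" for j
  define J where "J = {j. j0 \<le> j \<and> 2 ^ j \<le> m}"
  have finZ: "finite Z" unfolding Z_def using P by simp
  then have finA: "finite A" unfolding A_def by simp
  then have finD: "finite (D j)" for j unfolding D_def by simp
  have finp: "finite (points_on P l)" for l using P unfolding points_on_def by simp
  have "J \<subseteq> {..nat \<lceil>m\<rceil>}"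
  proof
    fix j assume "j \<in> J"
    then have "2 ^ j \<le> m" unfolding J_def by simp
    then have "real j < m" using of_nat_less_two_power[of j, where ?'a = real] by linarith
    then show "j \<in> {..nat \<lceil>m\<rceil>}" by simp linarith
  qed
  then have finJ: "finite J" by (rule finite_subset) simp
  have "R \<subseteq> (\<Union>j\<in>J. \<Union>l\<in>D j. points_on P l \<times> points_on P l)"
  proof
    fix x assume x: "x \<in> R"
    define l where "l = line_of (fst x) (snd x)"
    have c: "2 ^ j0 \<le> card (points_on P l)" "x \<in> Z" using x unfolding R_def l_def by auto
    then have lA: "l \<in> A" unfolding A_def l_def by blast
    have "(1::nat) \<le> 2 ^ j0" by simp
    then have "1 \<le> card (points_on P l)" using c by linarith
    then obtain j where j: "2 ^ j \<le> card (points_on P l)" "card (points_on P l) < 2 ^ Suc j"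
      by (rule dyadic_exponent)
    have "(2::nat) ^ j0 < 2 ^ Suc j" using c j by linarith
    then have "j0 < Suc j" by (simp only: power_strict_increasing_iff)
    moreover have "2 ^ j \<le> m"
    proof -
      have "\<bar>fst l\<bar> \<le> B" using c unfolding Z_def l_def line_of_def by simp
      then have "real (card (points_on P l)) \<le> m" using L by blast
      moreover have "real (2 ^ j) \<le> real (card (points_on P l))" using j(1) by (simp only: of_nat_le_iff)
      moreover have "real (2 ^ j) = 2 ^ j" by simp
      ultimately show ?thesis by linarith
    qed
    ultimately have "j \<in> J" unfolding J_def by simp
    moreover have "l \<in> D j" using lA j unfolding D_def by simp
    moreover have "x \<in> points_on P l \<times> points_on P l"
      using c points_on_line_of[of "fst x" "snd x" P] unfolding Z_def l_def by (auto simp: mem_Times_iff)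
    ultimately show "x \<in> (\<Union>j\<in>J. \<Union>l\<in>D j. points_on P l \<times> points_on P l)" by blast
  qed
  then have "card R \<le> card (\<Union>j\<in>J. \<Union>l\<in>D j. points_on P l \<times> points_on P l)"
    using finJ finD finp by (intro card_mono) auto
  also have "\<dots> \<le> (\<Sum>j\<in>J. card (\<Union>l\<in>D j. points_on P l \<times> points_on P l))"
    using finJ by (rule card_UN_le)
  also have "\<dots> \<le> (\<Sum>j\<in>J. \<Sum>l\<in>D j. card (points_on P l \<times> points_on P l))"
    by (intro sum_mono card_UN_le finD)
  also have "\<dots> \<le> (\<Sum>j\<in>J. \<Sum>l\<in>D j. 2 ^ Suc j * 2 ^ Suc j)"
    unfolding card_cartesian_product by (intro sum_mono mult_le_mono less_imp_le) (simp_all add: D_def)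
  also have "\<dots> = (\<Sum>j\<in>J. card (D j) * (2 ^ Suc j * 2 ^ Suc j))" by simp
  finally have "real (card R) \<le> real (\<Sum>j\<in>J. card (D j) * (2 ^ Suc j * 2 ^ Suc j))"
    by (simp only: of_nat_le_iff)
  also have "\<dots> = (\<Sum>j\<in>J. real (card (D j)) * (2 ^ Suc j * 2 ^ Suc j))" by simp
  also have "\<dots> \<le> (\<Sum>j\<in>J. 9216 * n ^ 2 * (1/2) ^ j + 48 * n * 2 ^ j)"
  proof (rule sum_mono)
    fix j assume "j \<in> J"
    then have "(2::nat) ^ 1 \<le> 2 ^ j" using j0 unfolding J_def by (intro power_increasing) auto
    then have "2 \<le> (2::nat) ^ j" by simp
    then have "real (card (D j)) \<le> 2304 * n ^ 2 / real (2 ^ j) ^ 3 + 12 * n / real (2 ^ j)"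
      unfolding n_def by (intro card_rich_lines_le P finD) (simp_all add: D_def)
    then have "real (card (D j)) * (2 ^ Suc j * 2 ^ Suc j)
      \<le> (2304 * n ^ 2 / (2 ^ j) ^ 3 + 12 * n / 2 ^ j) * (2 ^ Suc j * 2 ^ Suc j)"
      by (intro mult_right_mono) auto
    also have "\<dots> = 9216 * n ^ 2 * (1/2) ^ j + 48 * n * 2 ^ j"
      by (simp add: field_simps power3_eq_cube power_one_over)
    finally show "real (card (D j)) * (2 ^ Suc j * 2 ^ Suc j)
      \<le> 9216 * n ^ 2 * (1/2) ^ j + 48 * n * 2 ^ j" .
  qed
  also have "\<dots> = 9216 * n ^ 2 * (\<Sum>j\<in>J. (1/2) ^ j) + 48 * n * (\<Sum>j\<in>J. 2 ^ j)"
    by (simp only: sum.distrib sum_distrib_left)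
  also have "\<dots> \<le> 9216 * n ^ 2 * (2 * (1/2) ^ j0) + 48 * n * (2 * m)"
    using finJ m by (intro add_mono mult_left_mono sum_half_powers_le sum_powers_2_le)
      (auto simp: J_def n_def)
  also have "\<dots> = 18432 * n ^ 2 / 2 ^ j0 + 96 * n * m" by (simp add: power_one_over field_simps)
  finally show ?thesis unfolding R_def Z_def n_def by (simp add: conj_assoc)
qed

section \<open>Regular sets\<close>

text \<open>Balls of the maximum norm are squares, the sets for which regularity is stated.\<close>

definition dist_max :: "real \<times> real \<Rightarrow> real \<times> real \<Rightarrow> real" where
  "dist_max p q = max \<bar>fst p - fst q\<bar> \<bar>snd p - snd q\<bar>"

lemma sum_geometric_subset_le:
  fixes x :: real
  assumes "finite K" "0 \<le> x" "x < 1"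
  shows "(\<Sum>k\<in>K. x ^ k) \<le> 1 / (1 - x)"
proof -
  have "(\<Sum>k\<in>K. x ^ k) \<le> (\<Sum>k. x ^ k)"
    using assms by (intro sum_le_suminf summable_geometric) auto
  also have "\<dots> = 1 / (1 - x)" using assms by (intro suminf_geometric) auto
  finally show ?thesis .
qed

lemma dyadic_scale:
  fixes D \<tau> :: real
  assumes "0 < D" "D \<le> \<tau>"
  obtains k :: nat where "D \<le> \<tau> / 2 ^ k" "\<tau> / 2 ^ k < 2 * D"
proof -
  define k where "k = (LEAST k. \<tau> / 2 ^ k < 2 * D)"
  obtain k0 :: nat where "\<tau> / D < 2 ^ k0" using real_arch_pow[of 2 "\<tau> / D"] by auto
  then have "\<tau> < 2 ^ k0 * D" using assms by (simp add: field_simps)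
  also have "\<dots> \<le> 2 ^ k0 * (2 * D)" using assms by simp
  finally have "\<tau> / 2 ^ k0 < 2 * D" by (simp add: field_simps)
  then have 1: "\<tau> / 2 ^ k < 2 * D" unfolding k_def by (rule LeastI)
  have "D \<le> \<tau> / 2 ^ k"
  proof (cases k)
    case (Suc i)
    then have "i < k" by simp
    then have "\<not> \<tau> / 2 ^ i < 2 * D" unfolding k_def by (rule not_less_Least)
    then show ?thesis using Suc by (simp add: field_simps)
  qed (use assms in simp)
  then show ?thesis using 1 that by blast
qed

lemma finite_dyadic_above:
  fixes r \<tau> :: real
  assumes "0 < r" shows "finite {k::nat. r \<le> \<tau> / 2 ^ k}"
proof -
  obtain k0 :: nat where k0: "\<tau> / r < 2 ^ k0" using real_arch_pow[of 2 "\<tau> / r"] by auto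
  have "{k::nat. r \<le> \<tau> / 2 ^ k} \<subseteq> {..k0}"
  proof
    fix k :: nat assume "k \<in> {k. r \<le> \<tau> / 2 ^ k}"
    then have "2 ^ k \<le> \<tau> / r" using assms by (simp add: field_simps)
    then have "(2::real) ^ k < 2 ^ k0" using k0 by linarith
    then show "k \<in> {..k0}" by simp
  qed
  then show ?thesis by (rule finite_subset) simp
qed

section \<open>Point counts in squares, strips and balls\<close>

lemma card_cover_squares_le:
  assumes "finite P" "regular_above_scale s \<delta> C P" "\<delta> < W" "S \<subseteq> P"
    and "\<And>q. q \<in> S \<Longrightarrow> \<exists>i<m::nat. q \<in> {a i..a i + W} \<times> {b i..b i + W}"
  shows "real (card S) \<le> real m * (C * real (card P) * W powr s)"
proof -
  have "S \<subseteq> (\<Union>i<m. P \<inter> ({a i..a i + W} \<times> {b i..b i + W}))" using assms by blast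
  then have "card S \<le> card (\<Union>i<m. P \<inter> ({a i..a i + W} \<times> {b i..b i + W}))"
    using assms(1) by (intro card_mono) auto
  also have "\<dots> \<le> (\<Sum>i<m. card (P \<inter> ({a i..a i + W} \<times> {b i..b i + W})))"
    by (intro card_UN_le) simp
  finally have "real (card S) \<le> real (\<Sum>i<m. card (P \<inter> ({a i..a i + W} \<times> {b i..b i + W})))"
    by (simp only: of_nat_le_iff)
  also have "\<dots> = (\<Sum>i<m. real (card (P \<inter> ({a i..a i + W} \<times> {b i..b i + W}))))" by simp
  also have "\<dots> \<le> (\<Sum>i<m. C * real (card P) * W powr s)"
    using assms(2,3) unfolding regular_above_scale_def by (intro sum_mono) blast
  finally show ?thesis by simp
qed

lemma unit_interval_cell:
  fixes x w :: real
  assumes "0 \<le> x" "x \<le> 1" "0 < w"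
  obtains i where "i < nat \<lfloor>1 / w\<rfloor> + 1" "real i * w \<le> x" "x \<le> real i * w + w"
proof -
  define i where "i = nat \<lfloor>x / w\<rfloor>"
  have "x / w \<le> 1 / w" using assms by (intro divide_right_mono) auto
  then have "i < nat \<lfloor>1 / w\<rfloor> + 1" unfolding i_def by (simp add: floor_mono nat_mono less_Suc_eq_le)
  moreover have "0 \<le> x / w" using assms by simp
  then have "real i \<le> x / w" "x / w \<le> real i + 1" unfolding i_def by linarith+
  then have "real i * w \<le> x" "x \<le> real i * w + w" using assms by (simp_all add: field_simps)
  ultimately show ?thesis using that by blast
qed

lemma cell_count_le:
  fixes w :: real assumes "0 < w" "w \<le> 2" shows "real (nat \<lfloor>1 / w\<rfloor> + 1) \<le> 3 / w"
proof -
  have "real (nat \<lfloor>1 / w\<rfloor> + 1) \<le> 1 / w + 1" using assms by simp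
  also have "\<dots> \<le> 3 / w" using assms by (simp add: field_simps)
  finally show ?thesis .
qed

text \<open>A strip in the unit square is covered by about 1 / w squares of side comparable to w,
  which costs one power of w. For s > 1 a positive power remains, so thin strips, and lines in
  particular, hold few points.\<close>

lemma card_strip_le:
  fixes a B :: real
  assumes P: "finite P" "P \<subseteq> {0..1} \<times> {0..1}" and reg: "regular_above_scale s \<delta> C P"
    and "0 < C" "0 < \<delta>" "\<delta> < w" "w \<le> 2" "\<bar>a\<bar> \<le> B"
  shows "real (card {q \<in> P. \<bar>snd q - a * fst q - t\<bar> \<le> w})
    \<le> 3 * C * (B + 2) powr s * real (card P) * w powr (s - 1)"
proof -
  define m where "m = nat \<lfloor>1 / w\<rfloor> + 1"
  \<comment> \<open>Over an abscissa interval of length \<open>w\<close> the axis of the strip moves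
    vertically by at most \<open>B * w\<close>, and the strip itself adds
    \<open>2 * w\<close>.\<close>
  define W where "W = (B + 2) * w"
  have w0: "0 < w" using assms by simp
  have W: "w \<le> W" "\<bar>a\<bar> * w + 2 * w \<le> W"
    using assms w0 unfolding W_def by (auto simp: algebra_simps)
  have "real (card {q \<in> P. \<bar>snd q - a * fst q - t\<bar> \<le> w}) \<le> real m * (C * real (card P) * W powr s)"
  proof (rule card_cover_squares_le[OF P(1) reg, where a = "\<lambda>i. real i * w" and
        b = "\<lambda>i. a * (real i * w) + min 0 (a * w) + t - w"])
    fix q assume q: "q \<in> {q \<in> P. \<bar>snd q - a * fst q - t\<bar> \<le> w}"
    have "0 \<le> fst q" "fst q \<le> 1" using q P(2) by auto
    then obtain i where i: "i < m" "real i * w \<le> fst q" "fst q \<le> real i * w + w"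
      using unit_interval_cell[OF _ _ w0] unfolding m_def by blast
    define u where "u = fst q - real i * w"
    have u: "0 \<le> u" "u \<le> w" using i unfolding u_def by auto
    \<comment> \<open>The axis is lowest at the left or at the right end of the cell according to
      the sign of \<open>a\<close>; the minimum covers both cases.\<close>
    have "min 0 (a * w) \<le> a * u" "a * u \<le> min 0 (a * w) + \<bar>a\<bar> * w"
    proof -
      show "min 0 (a * w) \<le> a * u"
        using u mult_left_mono_neg[of u w a] by (cases "a \<ge> 0") (auto simp: min_le_iff_disj)
      show "a * u \<le> min 0 (a * w) + \<bar>a\<bar> * w"
      proof (cases "a \<ge> 0")
        case True
        then have "a * u \<le> a * w" "0 \<le> a * w" using u w0 by (simp_all add: mult_left_mono)
        then show ?thesis using True by simp
      next
        case False
        then have "a * u \<le> 0" "a * w \<le> 0" using u w0 by (simp_all add: mult_nonpos_nonneg)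
        then show ?thesis using False by simp
      qed
    qed
    moreover have "a * fst q = a * (real i * w) + a * u" unfolding u_def by (simp add: algebra_simps)
    moreover have "\<bar>snd q - a * fst q - t\<bar> \<le> w" using q by simp
    ultimately have "a * (real i * w) + min 0 (a * w) + t - w \<le> snd q"
      "snd q \<le> a * (real i * w) + min 0 (a * w) + t - w + W" using W by linarith+
    moreover have "fst q \<le> real i * w + W" using i W by linarith
    ultimately show "\<exists>i<m. q \<in> {real i * w..real i * w + W} \<times>
        {a * (real i * w) + min 0 (a * w) + t - w..a * (real i * w) + min 0 (a * w) + t - w + W}"
      using i by (intro exI[of _ i]) (auto simp: mem_Times_iff)
  qed (use W assms in auto)
  also have "\<dots> \<le> 3 / w * (C * real (card P) * W powr s)"
    unfolding m_def using assms w0 by (intro mult_right_mono cell_count_le) auto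
  also have "W powr s = (B + 2) powr s * (w powr (s - 1) * w)"
    using assms w0 unfolding W_def by (simp add: powr_mult powr_diff)
  finally show ?thesis using w0 by (simp add: mult_ac)
qed

lemma card_vertical_strip_le:
  assumes P: "finite P" "P \<subseteq> {0..1} \<times> {0..1}" and reg: "regular_above_scale s \<delta> C P"
    and "0 < C" "0 < \<delta>" "\<delta> < w" "w \<le> 2"
  shows "real (card {q \<in> P. \<bar>fst q - t\<bar> \<le> w}) \<le> 3 * C * 2 powr s * real (card P) * w powr (s - 1)"
proof -
  define m where "m = nat \<lfloor>1 / w\<rfloor> + 1"
  have w0: "0 < w" using assms by simp
  have "real (card {q \<in> P. \<bar>fst q - t\<bar> \<le> w}) \<le> real m * (C * real (card P) * (2 * w) powr s)"
  proof (rule card_cover_squares_le[OF P(1) reg, where a = "\<lambda>i. t - w" and b = "\<lambda>i. real i * w"])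
    fix q assume q: "q \<in> {q \<in> P. \<bar>fst q - t\<bar> \<le> w}"
    have "0 \<le> snd q" "snd q \<le> 1" using q P(2) by auto
    then obtain i where i: "i < m" "real i * w \<le> snd q" "snd q \<le> real i * w + w"
      using unit_interval_cell[OF _ _ w0] unfolding m_def by blast
    moreover have "\<bar>fst q - t\<bar> \<le> w" using q by simp
    ultimately show "\<exists>i<m. q \<in> {t - w..t - w + 2 * w} \<times> {real i * w..real i * w + 2 * w}"
      using w0 by (intro exI[of _ i]) (auto simp: mem_Times_iff abs_le_iff)
  qed (use assms in auto)
  also have "\<dots> \<le> 3 / w * (C * real (card P) * (2 * w) powr s)"
    unfolding m_def using assms w0 by (intro mult_right_mono cell_count_le) auto
  also have "(2 * w) powr s = 2 powr s * (w powr (s - 1) * w)"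
    using w0 by (simp add: powr_mult powr_diff)
  finally show ?thesis using w0 by (simp add: mult_ac)
qed

lemma card_ball_le:
  assumes P: "finite P" and reg: "regular_above_scale s \<delta> C P" and "\<delta> < 2 * \<rho>"
  shows "real (card {q \<in> P. dist_max p q \<le> \<rho>}) \<le> C * real (card P) * (2 * \<rho>) powr s"
proof -
  have "real (card {q \<in> P. dist_max p q \<le> \<rho>}) \<le> real 1 * (C * real (card P) * (2 * \<rho>) powr s)"
    by (rule card_cover_squares_le[OF P reg, where a = "\<lambda>i. fst p - \<rho>" and b = "\<lambda>i. snd p - \<rho>"])
      (use assms in \<open>auto simp: dist_max_def abs_le_iff mem_Times_iff\<close>)
  then show ?thesis by simp
qed

text \<open>Riesz energy of order 1, truncated at \<open>r\<close>. The points at distance about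
  \<tau> / 2^k number at most a constant times n (\<tau> / 2^k)^s and have weight about 2^k /
  \<tau>, so the contributions decay with ratio 2^(1-s), which is less than 1 as s > 1. The
  truncation keeps all squares above scale \<delta>.\<close>

lemma energy_le:
  assumes P: "finite P" and reg: "regular_above_scale s \<delta> C P"
    and "1 < s" "0 < C" "0 < \<delta>" "\<delta> \<le> r" "r \<le> \<tau>"
  shows "(\<Sum>q | q \<in> P \<and> dist_max p q \<le> \<tau>. 1 / max r (dist_max p q))
    \<le> 2 * 2 powr s * C / (1 - 2 powr (1 - s)) * real (card P) * \<tau> powr (s - 1)"
proof -
  define K where "K = {k::nat. r \<le> \<tau> / 2 ^ k}"
  define d where "d = dist_max p"
  have r: "0 < r" using assms by simp
  have finK: "finite K" unfolding K_def using r by (rule finite_dyadic_above)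
  have \<tau>: "0 < \<tau>" using r assms by simp
  \<comment> \<open>The single dyadic radius within a factor 2 of the truncated distance already
    dominates the left side; the other terms are nonnegative.\<close>
  have pt: "1 / max r (d q) \<le> (\<Sum>k\<in>K. 2 * 2 ^ k / \<tau> * of_bool (d q \<le> \<tau> / 2 ^ k))"
    if "d q \<le> \<tau>" for q
  proof -
    have D: "0 < max r (d q)" "max r (d q) \<le> \<tau>" using r assms that by auto
    then obtain k where k: "max r (d q) \<le> \<tau> / 2 ^ k" "\<tau> / 2 ^ k < 2 * max r (d q)"
      by (rule dyadic_scale)
    have "1 / max r (d q) \<le> 2 * 2 ^ k / \<tau>"
      using k(2) D \<tau> by (simp add: field_simps)
    also have "\<dots> = (\<Sum>k\<in>{k}. 2 * 2 ^ k / \<tau> * of_bool (d q \<le> \<tau> / 2 ^ k))" using k by simp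
    also have "\<dots> \<le> (\<Sum>k\<in>K. 2 * 2 ^ k / \<tau> * of_bool (d q \<le> \<tau> / 2 ^ k))"
      using k \<tau> finK by (intro sum_mono2) (auto simp: K_def)
    finally show ?thesis .
  qed
  have "(\<Sum>q | q \<in> P \<and> d q \<le> \<tau>. 1 / max r (d q))
    \<le> (\<Sum>q | q \<in> P \<and> d q \<le> \<tau>. \<Sum>k\<in>K. 2 * 2 ^ k / \<tau> * of_bool (d q \<le> \<tau> / 2 ^ k))"
    using pt by (intro sum_mono) auto
  also have "\<dots> = (\<Sum>k\<in>K. \<Sum>q | q \<in> P \<and> d q \<le> \<tau>. 2 * 2 ^ k / \<tau> * of_bool (d q \<le> \<tau> / 2 ^ k))"
    by (rule sum.swap)
  also have "\<dots> \<le> (\<Sum>k\<in>K. 2 * 2 powr s * C * real (card P) * \<tau> powr (s - 1) * (2 powr (1 - s)) ^ k)"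
  proof (rule sum_mono)
    fix k assume k: "k \<in> K"
    have "(\<Sum>q | q \<in> P \<and> d q \<le> \<tau>. 2 * 2 ^ k / \<tau> * of_bool (d q \<le> \<tau> / 2 ^ k))
      \<le> (\<Sum>q\<in>P. 2 * 2 ^ k / \<tau> * of_bool (d q \<le> \<tau> / 2 ^ k))"
      using P \<tau> by (intro sum_mono2) auto
    also have "\<dots> = 2 * 2 ^ k / \<tau> * real (card {q \<in> P. d q \<le> \<tau> / 2 ^ k})"
      unfolding sum_distrib_left[symmetric] using P by (simp add: Int_def)
    also have "\<dots> \<le> 2 * 2 ^ k / \<tau> * (C * real (card P) * (2 * (\<tau> / 2 ^ k)) powr s)"
      using k r assms \<tau> unfolding d_def K_def by (intro mult_left_mono card_ball_le[OF P reg]) auto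
    also have "(2 * (\<tau> / 2 ^ k)) powr s = 2 powr s * (\<tau> powr (s - 1) * \<tau>) / (2 ^ k) powr s"
      using \<tau> by (simp add: powr_mult powr_divide powr_diff)
    also have "(2 ^ k) powr s = 2 ^ k / (2 powr (1 - s)) ^ k"
    proof -
      have "(2 powr (1 - s)) ^ k = 2 powr ((1 - s) * real k)"
        by (simp add: powr_powr flip: powr_realpow)
      moreover have "(2 ^ k) powr s = 2 powr (real k * s)"
        by (simp add: powr_powr flip: powr_realpow)
      moreover have "(2::real) ^ k = 2 powr real k" by (simp add: powr_realpow)
      ultimately show ?thesis by (simp add: algebra_simps flip: powr_diff)
    qed
    finally show "(\<Sum>q | q \<in> P \<and> d q \<le> \<tau>. 2 * 2 ^ k / \<tau> * of_bool (d q \<le> \<tau> / 2 ^ k))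
      \<le> 2 * 2 powr s * C * real (card P) * \<tau> powr (s - 1) * (2 powr (1 - s)) ^ k"
      using \<tau> by (simp add: field_simps)
  qed
  also have "\<dots> = 2 * 2 powr s * C * real (card P) * \<tau> powr (s - 1) * (\<Sum>k\<in>K. (2 powr (1 - s)) ^ k)"
    by (simp add: sum_distrib_left)
  also have "\<dots> \<le> 2 * 2 powr s * C * real (card P) * \<tau> powr (s - 1) * (1 / (1 - 2 powr (1 - s)))"
    using assms finK by (intro mult_left_mono sum_geometric_subset_le) (auto simp: powr_less_one)
  finally show ?thesis unfolding d_def by (simp add: mult_ac)
qed

section \<open>Smoothed projections\<close>

text \<open>The length of the intersection of two intervals of radii \<open>\<rho>\<close> and \<open>\<rho>'\<close> whose centres
  differ by \<open>u\<close>.\<close>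

definition overlap :: "real \<Rightarrow> real \<Rightarrow> real \<Rightarrow> real" where
  "overlap \<rho> \<rho>' u = max 0 (u + (\<rho> + \<rho>')) - max 0 (u + (\<rho>' - \<rho>)) - max 0 (u - (\<rho>' - \<rho>))
     + max 0 (u - (\<rho> + \<rho>'))"

lemma overlap_eq:
  assumes "0 < \<rho>" "0 < \<rho>'"
  shows "overlap \<rho> \<rho>' (x - y) = max 0 (min (x + \<rho>) (y + \<rho>') - max (x - \<rho>) (y - \<rho>'))"
  using assms unfolding overlap_def by (smt (verit))

lemma overlap_nonneg: "0 < \<rho> \<Longrightarrow> 0 < \<rho>' \<Longrightarrow> 0 \<le> overlap \<rho> \<rho>' u"
  using overlap_eq[of \<rho> \<rho>' u 0] by simp

lemma overlap_self_le: "0 < \<rho> \<Longrightarrow> overlap \<rho> \<rho> u \<le> 2 * \<rho>"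
  unfolding overlap_def by (smt (verit))

lemma overlap_self_ge: "0 < \<rho> \<Longrightarrow> \<bar>u\<bar> \<le> \<rho> \<Longrightarrow> \<rho> \<le> overlap \<rho> \<rho> u"
  unfolding overlap_def by (smt (verit))

lemma overlap_eq_0: "0 < \<rho> \<Longrightarrow> 0 < \<rho>' \<Longrightarrow> \<rho> + \<rho>' \<le> \<bar>u\<bar> \<Longrightarrow> overlap \<rho> \<rho>' u = 0"
  unfolding overlap_def by (smt (verit))

lemma continuous_overlap [continuous_intros]:
  "continuous_on S f \<Longrightarrow> continuous_on S (\<lambda>a. overlap \<rho> \<rho>' (f a))"
  unfolding overlap_def
  by (intro continuous_on_add continuous_on_diff continuous_on_max continuous_on_const)

lemma has_integral_overlap:
  assumes "0 < \<rho>" "0 < \<rho>'"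
  shows "has_bochner_integral lborel
    (\<lambda>t. indicator {x - \<rho>..x + \<rho>} t * indicator {y - \<rho>'..y + \<rho>'} t :: real) (overlap \<rho> \<rho>' (x - y))"
proof -
  let ?a = "max (x - \<rho>) (y - \<rho>')" and ?b = "min (x + \<rho>) (y + \<rho>')"
  have "{x - \<rho>..x + \<rho>} \<inter> {y - \<rho>'..y + \<rho>'} = {?a..?b}" by auto
  then have "(\<lambda>t. indicator {x - \<rho>..x + \<rho>} t * indicator {y - \<rho>'..y + \<rho>'} t :: real) = indicator {?a..?b}"
    by (simp add: fun_eq_iff flip: indicator_inter_arith)
  moreover have "has_bochner_integral lborel (indicator {?a..?b} :: real \<Rightarrow> real) (measure lborel {?a..?b})"
    by (rule has_bochner_integral_real_indicator) (auto simp: emeasure_lborel_Icc_eq)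
  moreover have "measure lborel {?a..?b} = overlap \<rho> \<rho>' (x - y)"
    unfolding overlap_eq[OF assms] by (cases "?a \<le> ?b") (auto simp: max_def)
  ultimately show ?thesis by simp
qed

text \<open>The form is the integral of the square of \<alpha> times the sum of the indicators of
  radius \<rho> plus \<beta> times that of radius \<rho>'.\<close>

lemma overlap_positive_semidefinite:
  fixes x :: "'a \<Rightarrow> real" and \<alpha> \<beta> :: real
  assumes "finite S" "0 < \<rho>" "0 < \<rho>'"
  shows "0 \<le> \<alpha>\<^sup>2 * (\<Sum>p\<in>S. \<Sum>q\<in>S. overlap \<rho> \<rho> (x p - x q))
    + 2 * \<alpha> * \<beta> * (\<Sum>p\<in>S. \<Sum>q\<in>S. overlap \<rho> \<rho>' (x p - x q))
    + \<beta>\<^sup>2 * (\<Sum>p\<in>S. \<Sum>q\<in>S. overlap \<rho>' \<rho>' (x p - x q))" (is "0 \<le> ?R")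
proof -
  define i where "i \<rho> p t = (indicator {x p - \<rho>..x p + \<rho>} t :: real)" for \<rho> p t
  have int: "has_bochner_integral lborel (\<lambda>t. \<Sum>p\<in>S. \<Sum>q\<in>S. i \<sigma> p t * i \<tau> q t)
      (\<Sum>p\<in>S. \<Sum>q\<in>S. overlap \<sigma> \<tau> (x p - x q))" if "0 < \<sigma>" "0 < \<tau>" for \<sigma> \<tau>
    unfolding i_def using that by (intro has_bochner_integral_sum has_integral_overlap)
  have "has_bochner_integral lborel
     (\<lambda>t. \<alpha>\<^sup>2 * (\<Sum>p\<in>S. \<Sum>q\<in>S. i \<rho> p t * i \<rho> q t) + 2 * \<alpha> * \<beta> * (\<Sum>p\<in>S. \<Sum>q\<in>S. i \<rho> p t * i \<rho>' q t)
       + \<beta>\<^sup>2 * (\<Sum>p\<in>S. \<Sum>q\<in>S. i \<rho>' p t * i \<rho>' q t)) ?R"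
    using assms by (intro has_bochner_integral_add has_bochner_integral_mult_right int) auto
  moreover have "\<alpha>\<^sup>2 * (\<Sum>p\<in>S. \<Sum>q\<in>S. i \<rho> p t * i \<rho> q t) + 2 * \<alpha> * \<beta> * (\<Sum>p\<in>S. \<Sum>q\<in>S. i \<rho> p t * i \<rho>' q t)
       + \<beta>\<^sup>2 * (\<Sum>p\<in>S. \<Sum>q\<in>S. i \<rho>' p t * i \<rho>' q t)
      = (\<alpha> * (\<Sum>p\<in>S. i \<rho> p t) + \<beta> * (\<Sum>p\<in>S. i \<rho>' p t))\<^sup>2" for t
    unfolding sum_product[symmetric] by (simp add: power2_eq_square algebra_simps)
  ultimately have "has_bochner_integral lborel
     (\<lambda>t. (\<alpha> * (\<Sum>p\<in>S. i \<rho> p t) + \<beta> * (\<Sum>p\<in>S. i \<rho>' p t))\<^sup>2) ?R" by simp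
  then have "?R = integral\<^sup>L lborel (\<lambda>t. (\<alpha> * (\<Sum>p\<in>S. i \<rho> p t) + \<beta> * (\<Sum>p\<in>S. i \<rho>' p t))\<^sup>2)"
    by (simp add: has_bochner_integral_integral_eq)
  then show ?thesis by simp
qed

section \<open>An antiderivative of the overlap\<close>

definition sqramp :: "real \<Rightarrow> real" where "sqramp u = (max 0 u)\<^sup>2 / 2"

lemma has_derivative_sqramp: "(sqramp has_real_derivative max 0 u) (at u)"
proof -
  consider "u < 0" | "u = 0" | "0 < u" by linarith
  then show ?thesis
  proof cases
    case 1
    have "((\<lambda>u. 0) has_real_derivative 0) (at u)" by simp
    then have "(sqramp has_real_derivative 0) (at u)"
      by (rule DERIV_cong_ev[THEN iffD1, rotated -1])
        (use 1 in \<open>auto simp: sqramp_def max_def intro!: eventually_mono[OF eventually_nhds_in_open[of "{..<0}"]]\<close>)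
    then show ?thesis using 1 by simp
  next
    case 2
    have "((\<lambda>y. \<bar>y\<bar> / 2) \<longlongrightarrow> \<bar>0\<bar> / 2) (at (0::real))" by (intro tendsto_intros) simp
    then have lim: "((\<lambda>y. \<bar>y\<bar> / 2) \<longlongrightarrow> 0) (at (0::real))" by simp
    have "((\<lambda>y. (sqramp y - sqramp 0) / (y - 0)) \<longlongrightarrow> 0) (at 0)"
      by (rule Lim_null_comparison[OF _ lim])
        (auto simp: sqramp_def max_def power2_eq_square intro!: always_eventually)
    then show ?thesis using 2 by (simp add: has_field_derivative_iff)
  next
    case 3
    have "((\<lambda>u. u\<^sup>2 / 2) has_real_derivative u) (at u)"
      by (auto intro!: derivative_eq_intros)
    then have "(sqramp has_real_derivative u) (at u)"
      by (rule DERIV_cong_ev[THEN iffD1, rotated -1])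
        (use 3 in \<open>auto simp: sqramp_def max_def intro!: eventually_mono[OF eventually_nhds_in_open[of "{0<..}"]]\<close>)
    then show ?thesis using 3 by simp
  qed
qed

text \<open>Writing the overlap as a combination of four ramps pays off here: each ramp integrates
  to a shifted \<open>sqramp\<close>, which gives the antiderivative that vanishes far to the
  left.\<close>

definition overlap_prim :: "real \<Rightarrow> real \<Rightarrow> real \<Rightarrow> real" where
  "overlap_prim \<rho> \<rho>' u = sqramp (u + (\<rho> + \<rho>')) - sqramp (u + (\<rho>' - \<rho>)) - sqramp (u - (\<rho>' - \<rho>))
     + sqramp (u - (\<rho> + \<rho>'))"

lemma has_derivative_overlap_prim:
  "(overlap_prim \<rho> \<rho>' has_real_derivative overlap \<rho> \<rho>' u) (at u)"
proof -
  have plus: "((\<lambda>u. sqramp (u + c)) has_real_derivative max 0 (u + c)) (at u)" for c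
    using has_derivative_sqramp[of "u + c"] by (simp only: DERIV_shift)
  have minus: "((\<lambda>u. sqramp (u - c)) has_real_derivative max 0 (u - c)) (at u)" for c
    using plus[of "- c"] by simp
  show ?thesis
    unfolding overlap_prim_def[abs_def] overlap_def by (intro DERIV_add DERIV_diff plus minus)
qed

lemma overlap_prim_left: "0 < \<rho> \<Longrightarrow> 0 < \<rho>' \<Longrightarrow> u \<le> - (\<rho> + \<rho>') \<Longrightarrow> overlap_prim \<rho> \<rho>' u = 0"
proof -
  assume a: "0 < \<rho>" "0 < \<rho>'" "u \<le> - (\<rho> + \<rho>')"
  have "sqramp v = 0" if "v \<le> 0" for v using that by (simp add: sqramp_def)
  then show ?thesis unfolding overlap_prim_def using a by simp
qed

text \<open>The overlap is the convolution of two indicators, so its total integral is the product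
  of the interval lengths 2 \<rho> and 2 \<rho>'.\<close>

lemma overlap_prim_right:
  assumes "0 < \<rho>" "0 < \<rho>'" "\<rho> + \<rho>' \<le> u" shows "overlap_prim \<rho> \<rho>' u = 4 * \<rho> * \<rho>'"
proof -
  have "max 0 (u + (\<rho> + \<rho>')) = u + (\<rho> + \<rho>')" "max 0 (u + (\<rho>' - \<rho>)) = u + (\<rho>' - \<rho>)"
    "max 0 (u - (\<rho>' - \<rho>)) = u - (\<rho>' - \<rho>)" "max 0 (u - (\<rho> + \<rho>')) = u - (\<rho> + \<rho>')"
    using assms by auto
  then show ?thesis unfolding overlap_prim_def sqramp_def
    by (simp add: power2_eq_square field_simps)
qed

lemma overlap_prim_mono:
  assumes "0 < \<rho>" "0 < \<rho>'" "u \<le> v" shows "overlap_prim \<rho> \<rho>' u \<le> overlap_prim \<rho> \<rho>' v"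
proof (rule DERIV_nonneg_imp_nondecreasing[OF assms(3)])
  show "\<exists>y. (overlap_prim \<rho> \<rho>' has_real_derivative y) (at x) \<and> 0 \<le> y" for x
    by (intro exI[of _ "overlap \<rho> \<rho>' x"] conjI has_derivative_overlap_prim overlap_nonneg[OF assms(1,2)])
qed

lemma overlap_prim_bounds:
  assumes "0 < \<rho>" "0 < \<rho>'" shows "0 \<le> overlap_prim \<rho> \<rho>' u" "overlap_prim \<rho> \<rho>' u \<le> 4 * \<rho> * \<rho>'"
proof -
  have "overlap_prim \<rho> \<rho>' (min u (- (\<rho> + \<rho>'))) \<le> overlap_prim \<rho> \<rho>' u"
    "overlap_prim \<rho> \<rho>' u \<le> overlap_prim \<rho> \<rho>' (max u (\<rho> + \<rho>'))"
    using assms by (auto intro!: overlap_prim_mono)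
  then show "0 \<le> overlap_prim \<rho> \<rho>' u" "overlap_prim \<rho> \<rho>' u \<le> 4 * \<rho> * \<rho>'"
    using assms by (simp_all add: overlap_prim_left overlap_prim_right)
qed

section \<open>Kernels averaged over slopes\<close>

text \<open>Here \<open>z\<close> is a difference of two points, and
  \<open>snd z - a * fst z\<close> is the difference of their projections along slope
  \<open>a\<close>. The division by \<rho> \<rho>' gives the smoothing kernels mass 2 at every
  scale; the slope integral is not divided by 2 B.\<close>

definition slope_mean :: "real \<Rightarrow> real \<Rightarrow> real \<Rightarrow> real \<times> real \<Rightarrow> real" where
  "slope_mean B \<rho> \<rho>' z = integral {-B..B} (\<lambda>a. overlap \<rho> \<rho>' (snd z - a * fst z)) / (\<rho> * \<rho>')"

lemma slope_mean_eq:
  assumes "fst z \<noteq> 0" "0 \<le> B"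
  shows "slope_mean B \<rho> \<rho>' z =
    (overlap_prim \<rho> \<rho>' (snd z + B * \<bar>fst z\<bar>) - overlap_prim \<rho> \<rho>' (snd z - B * \<bar>fst z\<bar>)) / \<bar>fst z\<bar> / (\<rho> * \<rho>')"
proof -
  define F where "F a = - overlap_prim \<rho> \<rho>' (snd z - a * fst z) / fst z" for a
  have "(F has_real_derivative overlap \<rho> \<rho>' (snd z - a * fst z)) (at a within {-B..B})" for a
    unfolding F_def using assms(1)
    by (auto intro!: derivative_eq_intros DERIV_chain2[OF has_derivative_overlap_prim])
  then have "((\<lambda>a. overlap \<rho> \<rho>' (snd z - a * fst z)) has_integral F B - F (-B)) {-B..B}"
    using assms(2) by (intro fundamental_theorem_of_calculus)
      (auto simp: has_real_derivative_iff_has_vector_derivative)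
  then have "integral {-B..B} (\<lambda>a. overlap \<rho> \<rho>' (snd z - a * fst z)) = F B - F (-B)"
    by (rule integral_unique)
  also have "\<dots> = (overlap_prim \<rho> \<rho>' (snd z + B * \<bar>fst z\<bar>) - overlap_prim \<rho> \<rho>' (snd z - B * \<bar>fst z\<bar>)) / \<bar>fst z\<bar>"
    unfolding F_def using assms(1) by (cases "fst z > 0") (auto simp: field_simps)
  finally show ?thesis unfolding slope_mean_def by simp
qed

lemma slope_mean_le:
  assumes "fst z \<noteq> 0" "0 \<le> B" "0 < \<rho>" "0 < \<rho>'"
  shows "slope_mean B \<rho> \<rho>' z \<le> 4 / \<bar>fst z\<bar>"
proof -
  have "slope_mean B \<rho> \<rho>' z \<le> (4 * \<rho> * \<rho>' - 0) / \<bar>fst z\<bar> / (\<rho> * \<rho>')"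
    unfolding slope_mean_eq[OF assms(1,2)] using assms
    by (intro divide_right_mono diff_mono overlap_prim_bounds) auto
  then show ?thesis using assms by simp
qed

text \<open>Averaging the overlap over slopes forgets the radii as soon as all slopes at which the
  intervals meet are covered. This is the source of cancellation between different scales.\<close>

lemma slope_mean_exact:
  assumes "0 \<le> B" "0 < \<rho>" "0 < \<rho>'" "\<bar>snd z\<bar> + \<rho> + \<rho>' \<le> B * \<bar>fst z\<bar>"
  shows "slope_mean B \<rho> \<rho>' z = 4 / \<bar>fst z\<bar>"
proof -
  have z: "fst z \<noteq> 0" using assms by auto
  have "overlap_prim \<rho> \<rho>' (snd z + B * \<bar>fst z\<bar>) = 4 * \<rho> * \<rho>'"
    "overlap_prim \<rho> \<rho>' (snd z - B * \<bar>fst z\<bar>) = 0"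
    using assms by (auto intro!: overlap_prim_left overlap_prim_right)
  then show ?thesis unfolding slope_mean_eq[OF z assms(1)] using assms by simp
qed

lemma slope_mean_0:
  assumes "0 < \<rho>" "0 < \<rho>'" "B * \<bar>fst z\<bar> + \<rho> + \<rho>' \<le> \<bar>snd z\<bar>"
  shows "slope_mean B \<rho> \<rho>' z = 0"
proof -
  have "overlap \<rho> \<rho>' (snd z - a * fst z) = 0" if "a \<in> {-B..B}" for a
  proof (rule overlap_eq_0)
    have "\<bar>a * fst z\<bar> \<le> B * \<bar>fst z\<bar>"
      using that unfolding abs_mult by (intro mult_right_mono) auto
    then show "\<rho> + \<rho>' \<le> \<bar>snd z - a * fst z\<bar>" using assms(3) by linarith
  qed (use assms in auto)
  then have "integral {-B..B} (\<lambda>a. overlap \<rho> \<rho>' (snd z - a * fst z)) = integral {-B..B} (\<lambda>a. 0)"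
    by (rule Henstock_Kurzweil_Integration.integral_cong)
  then show ?thesis unfolding slope_mean_def by simp
qed

lemma slope_mean_nonneg:
  assumes "0 < \<rho>" "0 < \<rho>'" shows "0 \<le> slope_mean B \<rho> \<rho>' z"
proof -
  have "(\<lambda>a. overlap \<rho> \<rho>' (snd z - a * fst z)) integrable_on {-B..B}"
    by (intro integrable_continuous_interval continuous_overlap continuous_intros)
  then have "0 \<le> integral {-B..B} (\<lambda>a. overlap \<rho> \<rho>' (snd z - a * fst z))"
    using overlap_nonneg[OF assms] by (rule Henstock_Kurzweil_Integration.integral_nonneg)
  then show ?thesis unfolding slope_mean_def using assms by simp
qed

lemma slope_mean_self_le:
  assumes "0 < \<rho>" "0 \<le> B" shows "slope_mean B \<rho> \<rho> z \<le> 4 * B / \<rho>"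
proof -
  have "integral {-B..B} (\<lambda>a. overlap \<rho> \<rho> (snd z - a * fst z)) \<le> integral {-B..B} (\<lambda>a. 2 * \<rho>)"
    using assms by (intro integral_le integrable_continuous_interval continuous_intros overlap_self_le) auto
  also have "\<dots> = 2 * B * (2 * \<rho>)" using assms by simp
  finally have "slope_mean B \<rho> \<rho> z \<le> 2 * B * (2 * \<rho>) / (\<rho> * \<rho>)"
    unfolding slope_mean_def using assms by (intro divide_right_mono) auto
  then show ?thesis using assms by simp
qed

text \<open>If the mean is not zero, then |snd z| < B |fst z| + 2 \<rho>, so the maximum norm of
  \<open>z\<close> is at most (B + 2) max \<rho> |fst z|. This turns decay in the abscissa into
  decay in the distance.\<close>

lemma slope_mean_self_le_max:
  assumes "0 < \<rho>" "1 \<le> B"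
  shows "slope_mean B \<rho> \<rho> z \<le> 4 * B * (B + 2) / max \<rho> (max \<bar>fst z\<bar> \<bar>snd z\<bar>)"
proof (cases "B * \<bar>fst z\<bar> + 2 * \<rho> \<le> \<bar>snd z\<bar>")
  case True
  then have "slope_mean B \<rho> \<rho> z = 0" using assms by (intro slope_mean_0) auto
  then show ?thesis using assms by simp
next
  case False
  define M where "M = max \<rho> \<bar>fst z\<bar>"
  have M: "0 < M" "\<rho> \<le> M" "\<bar>fst z\<bar> \<le> M" using assms unfolding M_def by auto
  have 1: "slope_mean B \<rho> \<rho> z \<le> 4 * B / M"
  proof (cases "\<rho> \<le> \<bar>fst z\<bar>")
    case True
    then have "slope_mean B \<rho> \<rho> z \<le> 4 / \<bar>fst z\<bar>" using assms by (intro slope_mean_le) auto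
    also have "\<dots> \<le> 4 * B / \<bar>fst z\<bar>" using assms by (intro divide_right_mono) auto
    finally show ?thesis using True unfolding M_def by simp
  next
    case False
    then show ?thesis using slope_mean_self_le[of \<rho> B z] assms unfolding M_def by simp
  qed
  have "\<bar>snd z\<bar> \<le> B * M + 2 * M"
    using False M assms mult_left_mono[OF M(3), of B] by linarith
  moreover have "M \<le> (B + 2) * M" using assms M by simp
  ultimately have "max \<rho> (max \<bar>fst z\<bar> \<bar>snd z\<bar>) \<le> (B + 2) * M" using M by (simp add: algebra_simps)
  moreover have "0 < max \<rho> (max \<bar>fst z\<bar> \<bar>snd z\<bar>)" using assms by simp
  ultimately have "4 * B * (B + 2) / ((B + 2) * M) \<le> 4 * B * (B + 2) / max \<rho> (max \<bar>fst z\<bar> \<bar>snd z\<bar>)"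
    using assms M by (intro divide_left_mono) auto
  moreover have "4 * B * (B + 2) / ((B + 2) * M) = 4 * B / M" using assms by simp
  ultimately show ?thesis using 1 by simp
qed

text \<open>The contribution of a pair with difference \<open>z\<close> to the slope integral of the
  squared L2 distance between the smoothings at scales \<open>r\<close> and
  \<open>R\<close>.\<close>

definition scale_gap :: "real \<Rightarrow> real \<Rightarrow> real \<Rightarrow> real \<times> real \<Rightarrow> real" where
  "scale_gap B r R z = slope_mean B r r z - 2 * slope_mean B r R z + slope_mean B R R z"

text \<open>Unless \<open>z\<close> is within 2 R of the cone |snd z| = B |fst z|, the three means
  are all 0 or all 4 / |fst z|, and they cancel. Near the cone there is no cancellation: for |fst z|
  >= \<tau> each mean is at most 4 / \<tau>, and otherwise \<open>z\<close> is within (B + 2) \<tau>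
  of the origin, where the distance kernel is used. The cut \<tau> is chosen later.\<close>

lemma scale_gap_le:
  assumes "0 < r" "r \<le> R" "R \<le> \<tau>" "1 \<le> B"
  shows "scale_gap B r R z \<le> 8 * B * (B + 2) *
    ((if max \<bar>fst z\<bar> \<bar>snd z\<bar> \<le> (B + 2) * \<tau> then 1 / max r (max \<bar>fst z\<bar> \<bar>snd z\<bar>) else 0)
     + (if \<bar>\<bar>snd z\<bar> - B * \<bar>fst z\<bar>\<bar> \<le> 2 * R then 1 / \<tau> else 0))"
proof -
  have R: "0 < R" "0 < \<tau>" using assms by auto
  define M where "M = max \<bar>fst z\<bar> \<bar>snd z\<bar>"
  define X where "X = (if M \<le> (B + 2) * \<tau> then 1 / max r M else 0)"
  define Y where "Y = (if \<bar>\<bar>snd z\<bar> - B * \<bar>fst z\<bar>\<bar> \<le> 2 * R then 1 / \<tau> else 0)"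
  have max0: "0 < max r M" "0 < max R M" using assms(1) R by (simp_all add: less_max_iff_disj)
  have X0: "0 \<le> X" and Y0: "0 \<le> Y" using max0 R unfolding X_def Y_def by simp_all
  have B0: "0 \<le> 8 * B * (B + 2)" using assms by simp
  have nonneg: "0 \<le> 8 * B * (B + 2) * (X + Y)"
    using X0 Y0 by (intro mult_nonneg_nonneg B0) simp
  have ub: "scale_gap B r R z \<le> slope_mean B r r z + slope_mean B R R z"
    unfolding scale_gap_def using slope_mean_nonneg[of r R B z] assms R by simp
  consider "B * \<bar>fst z\<bar> + 2 * R \<le> \<bar>snd z\<bar>" | "\<bar>snd z\<bar> + 2 * R \<le> B * \<bar>fst z\<bar>"
    | "\<bar>\<bar>snd z\<bar> - B * \<bar>fst z\<bar>\<bar> \<le> 2 * R" "\<bar>snd z\<bar> \<le> B * \<bar>fst z\<bar> + 2 * R" by linarith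
  then have "scale_gap B r R z \<le> 8 * B * (B + 2) * (X + Y)"
  proof cases
    case 1
    then have "scale_gap B r R z = 0"
      unfolding scale_gap_def using assms R by (simp add: slope_mean_0)
    then show ?thesis using nonneg by linarith
  next
    case 2
    then have "scale_gap B r R z = 0"
      unfolding scale_gap_def using assms R by (simp add: slope_mean_exact)
    then show ?thesis using nonneg by linarith
  next
    case 3
    have B: "1 \<le> B * (B + 2)" using assms mult_mono[of 1 B 1 "B + 2"] by simp
    show ?thesis
    proof (cases "\<tau> \<le> \<bar>fst z\<bar>")
      case True
      then have "fst z \<noteq> 0" using R by auto
      then have "scale_gap B r R z \<le> 4 / \<bar>fst z\<bar> + 4 / \<bar>fst z\<bar>"
        using slope_mean_le[of z B r r] slope_mean_le[of z B R R] assms R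
        by (intro order_trans[OF ub] add_mono) simp_all
      also have "\<dots> = 8 / \<bar>fst z\<bar>" by simp
      also have "\<dots> \<le> 8 / \<tau>" using True R by (intro divide_left_mono) auto
      also have "\<dots> = 8 * 1 * (1 / \<tau>)" by simp
      also have "\<dots> \<le> 8 * (B * (B + 2)) * (1 / \<tau>)" using B R by (intro mult_right_mono) auto
      also have "\<dots> = 8 * B * (B + 2) * (0 + Y)" unfolding Y_def using 3(1) by simp
      also have "\<dots> \<le> 8 * B * (B + 2) * (X + Y)" using X0 by (intro mult_left_mono B0) simp
      finally show ?thesis .
    next
      case False
      have "B * \<bar>fst z\<bar> \<le> B * \<tau>" using False assms by (intro mult_left_mono) auto
      moreover have "0 \<le> B * \<tau>" using assms R by simp
      moreover have "(B + 2) * \<tau> = B * \<tau> + 2 * \<tau>" by (simp add: algebra_simps)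
      ultimately have "\<bar>fst z\<bar> \<le> (B + 2) * \<tau>" "\<bar>snd z\<bar> \<le> (B + 2) * \<tau>"
        using 3(2) False assms(3) R by linarith+
      then have le: "M \<le> (B + 2) * \<tau>" unfolding M_def by simp
      have "scale_gap B r R z \<le> 4 * B * (B + 2) / max r M + 4 * B * (B + 2) / max R M"
        unfolding M_def using assms R
        by (intro order_trans[OF ub] add_mono slope_mean_self_le_max)
      also have "4 * B * (B + 2) / max R M \<le> 4 * B * (B + 2) / max r M"
        using assms max0 B0 by (intro divide_left_mono) (simp_all add: max.coboundedI1)
      also have "4 * B * (B + 2) / max r M + 4 * B * (B + 2) / max r M
        = 8 * B * (B + 2) * (X + 0)" unfolding X_def using le by simp
      also have "\<dots> \<le> 8 * B * (B + 2) * (X + Y)" using Y0 by (intro mult_left_mono B0) simp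
      finally show ?thesis by simp
    qed
  qed
  then show ?thesis unfolding X_def Y_def M_def .
qed

section \<open>From pairs with slopes in few cells to the scale gap\<close>

lemma sum_integral_cells:
  fixes f :: "real \<Rightarrow> real"
  assumes "continuous_on UNIV f" "0 < r"
  shows "(\<Sum>i<m. integral {c + real i * r..c + (real i + 1) * r} f) = integral {c..c + real m * r} f"
proof (induction m)
  case (Suc m)
  have "integral {c..c + real m * r} f + integral {c + real m * r..c + real (Suc m) * r} f
    = integral {c..c + real (Suc m) * r} f"
    using assms by (intro Henstock_Kurzweil_Integration.integral_combine integrable_continuous_interval
        continuous_on_subset[OF assms(1)]) (auto simp: algebra_simps)
  then show ?case using Suc by (simp add: algebra_simps)
qed simp

text \<open>The inner product of two smoothed projections along slope \<open>a\<close>, where the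
  smoothing at radius \<rho> counts, at t, the points projecting to within \<rho> of t, divided by
  \<rho>.\<close>

definition strip_energy :: "(real \<times> real) set \<Rightarrow> real \<Rightarrow> real \<Rightarrow> real \<Rightarrow> real" where
  "strip_energy P \<rho> \<rho>' a =
     (\<Sum>p\<in>P. \<Sum>q\<in>P. overlap \<rho> \<rho>' ((snd p - a * fst p) - (snd q - a * fst q))) / (\<rho> * \<rho>')"

lemma continuous_strip_energy: "continuous_on S (strip_energy P \<rho> \<rho>')"
  unfolding strip_energy_def[abs_def] divide_inverse
  by (intro continuous_on_mult_right continuous_on_sum continuous_overlap continuous_on_diff
      continuous_on_const continuous_on_id)

text \<open>The squared norm of the smoothing at \<open>r\<close> minus \<open>c\<close> times the
  smoothing at \<open>R\<close>. Below, c = 1 makes the gap nonnegative and c = 2 gives the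
  splitting into gap and coarse energy.\<close>

lemma strip_energy_quadratic:
  assumes "finite P" "0 < r" "0 < R"
  shows "0 \<le> strip_energy P r r a - 2 * c * strip_energy P r R a + c\<^sup>2 * strip_energy P R R a"
proof -
  have "0 \<le> (1 / r)\<^sup>2 * (strip_energy P r r a * (r * r)) + 2 * (1 / r) * (- c / R) * (strip_energy P r R a * (r * R))
     + (- c / R)\<^sup>2 * (strip_energy P R R a * (R * R))"
    unfolding strip_energy_def using overlap_positive_semidefinite[OF assms,
        where \<alpha> = "1 / r" and \<beta> = "- c / R" and x = "\<lambda>p. snd p - a * fst p"] assms by simp
  then show ?thesis using assms by (simp add: power2_eq_square)
qed

lemma strip_energy_self_le:
  assumes "0 < R" shows "strip_energy P R R a \<le> 2 * real (card P) ^ 2 / R"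
proof -
  have "(\<Sum>p\<in>P. \<Sum>q\<in>P. overlap R R ((snd p - a * fst p) - (snd q - a * fst q))) \<le> (\<Sum>p\<in>P. \<Sum>q\<in>P. 2 * R)"
    using assms by (intro sum_mono overlap_self_le)
  then have "strip_energy P R R a \<le> (\<Sum>p\<in>P. \<Sum>q\<in>P. 2 * R) / (R * R)"
    unfolding strip_energy_def using assms by (intro divide_right_mono) auto
  then show ?thesis using assms by (simp add: power2_eq_square mult_ac)
qed

lemma integral_strip_energy:
  "integral {-B..B} (strip_energy P \<rho> \<rho>') = (\<Sum>p\<in>P. \<Sum>q\<in>P. slope_mean B \<rho> \<rho>' (p - q))"
  if "finite P"
proof -
  have eq: "(snd p - a * fst p) - (snd q - a * fst q) = snd (p - q) - a * fst (p - q)" for p q :: "real \<times> real" and a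
    by (simp add: algebra_simps)
  have "integral {-B..B} (strip_energy P \<rho> \<rho>') =
    integral {-B..B} (\<lambda>a. \<Sum>p\<in>P. \<Sum>q\<in>P. overlap \<rho> \<rho>' (snd (p - q) - a * fst (p - q))) / (\<rho> * \<rho>')"
    unfolding strip_energy_def[abs_def] eq by simp
  also have "\<dots> = (\<Sum>p\<in>P. \<Sum>q\<in>P. integral {-B..B} (\<lambda>a. overlap \<rho> \<rho>' (snd (p - q) - a * fst (p - q)))) / (\<rho> * \<rho>')"
    using that by (simp add: integral_sum integrable_continuous_interval continuous_intros)
  finally show ?thesis unfolding slope_mean_def by (simp add: sum_divide_distrib)
qed

text \<open>Pairs in \<open>T i\<close> have projections within \<open>r\<close> for every slope of
  cell \<open>i\<close>, so the energy at scale \<open>r\<close> counts them throughout that cell.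
  It is at most twice the squared distance to the smoothing at scale \<open>R\<close> plus twice the
  energy at scale \<open>R\<close>; the latter has a pointwise bound, which is integrated only over
  the cells in \<open>I\<close>.\<close>

lemma sum_card_cells_le:
  fixes B r R :: real and m :: nat
  assumes P: "finite P" and r: "0 < r" "0 < R" and m: "real m * r = 2 * B" and I: "I \<subseteq> {..<m}"
    and T: "\<And>i. i \<in> I \<Longrightarrow> T i \<subseteq> P \<times> P"
    and near: "\<And>i p q a. i \<in> I \<Longrightarrow> (p, q) \<in> T i \<Longrightarrow> -B + real i * r \<le> a \<Longrightarrow> a \<le> -B + (real i + 1) * r
      \<Longrightarrow> \<bar>(snd p - a * fst p) - (snd q - a * fst q)\<bar> \<le> r"
  shows "(\<Sum>i\<in>I. real (card (T i)))
    \<le> 2 * (\<Sum>p\<in>P. \<Sum>q\<in>P. scale_gap B r R (p - q)) + 4 * real (card P) ^ 2 * real (card I) * r / R"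
proof -
  define n where "n = real (card P)"
  define N where "N a = strip_energy P r r a - 2 * strip_energy P r R a + strip_energy P R R a" for a
  have N0: "0 \<le> N a" for a unfolding N_def using strip_energy_quadratic[OF P r, of a 1] by simp
  have contN: "continuous_on S N" for S
    unfolding N_def[abs_def] by (intro continuous_intros continuous_strip_energy)
  define J where "J i = {-B + real i * r..-B + (real i + 1) * r}" for i
  have cell: "real (card (T i)) \<le> 2 * integral (J i) N + 4 * n ^ 2 * r / R" if i: "i \<in> I" for i
  proof -
    have pt: "real (card (T i)) / r \<le> 2 * N a + 4 * n ^ 2 / R" if a: "a \<in> J i" for a
    proof -
      define g where "g x = overlap r r ((snd (fst x) - a * fst (fst x)) - (snd (snd x) - a * fst (snd x)))" for x :: "(real \<times> real) \<times> (real \<times> real)"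
      have "real (card (T i)) * r = (\<Sum>x\<in>T i. r)" by simp
      also have "\<dots> \<le> (\<Sum>x\<in>T i. g x)"
        unfolding g_def using near[OF i] a r by (intro sum_mono overlap_self_ge) (auto simp: J_def)
      also have "\<dots> \<le> (\<Sum>x\<in>P \<times> P. g x)"
        using T[OF i] P r unfolding g_def by (intro sum_mono2 overlap_nonneg) auto
      also have "\<dots> = strip_energy P r r a * (r * r)"
        using r unfolding strip_energy_def g_def by (simp add: sum.cartesian_product case_prod_unfold)
      finally have "real (card (T i)) / r \<le> strip_energy P r r a" using r by (simp add: field_simps)
      \<comment> \<open>With c = 2 the quadratic form is exactly the right side minus the left
        side.\<close>
      also have "\<dots> \<le> 2 * N a + 2 * strip_energy P R R a"
        using strip_energy_quadratic[OF P r, of a 2] unfolding N_def by simp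
      also have "\<dots> \<le> 2 * N a + 2 * (2 * n ^ 2 / R)"
        unfolding n_def using strip_energy_self_le[OF r(2)] by (intro add_left_mono mult_left_mono) auto
      finally show ?thesis by simp
    qed
    have len: "-B + real i * r \<le> -B + (real i + 1) * r" using r by (simp add: algebra_simps)
    have "integral (J i) (\<lambda>a. real (card (T i)) / r) \<le> integral (J i) (\<lambda>a. 2 * N a + 4 * n ^ 2 / R)"
      unfolding J_def by (intro integral_le integrable_continuous_interval continuous_intros contN pt)
        (simp_all add: J_def)
    also have "\<dots> = integral (J i) (\<lambda>a. 2 * N a) + integral (J i) (\<lambda>a. 4 * n ^ 2 / R)"
      unfolding J_def by (intro Henstock_Kurzweil_Integration.integral_add integrable_continuous_interval
          continuous_intros contN)
    finally show ?thesis using r len unfolding J_def by (simp add: algebra_simps)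
  qed
  have "(\<Sum>i\<in>I. real (card (T i))) \<le> (\<Sum>i\<in>I. 2 * integral (J i) N + 4 * n ^ 2 * r / R)"
    by (intro sum_mono cell)
  also have "\<dots> = 2 * (\<Sum>i\<in>I. integral (J i) N) + 4 * n ^ 2 * real (card I) * r / R"
    by (simp add: sum.distrib sum_distrib_left)
  \<comment> \<open>Nonnegativity of \<open>N\<close> allows the passage to all cells; the integral
    over the full slope range is the one with cancellation.\<close>
  also have "(\<Sum>i\<in>I. integral (J i) N) \<le> (\<Sum>i<m. integral (J i) N)"
    using I N0 unfolding J_def
    by (intro sum_mono2 Henstock_Kurzweil_Integration.integral_nonneg integrable_continuous_interval contN) auto
  also have "\<dots> = integral {-B..-B + real m * r} N"
    unfolding J_def by (rule sum_integral_cells[OF contN r(1)])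
  also have "\<dots> = integral {-B..B} N" using m by simp
  also have "\<dots> = integral {-B..B} (strip_energy P r r) - 2 * integral {-B..B} (strip_energy P r R)
      + integral {-B..B} (strip_energy P R R)"
    unfolding N_def[abs_def]
    by (simp add: Henstock_Kurzweil_Integration.integral_add Henstock_Kurzweil_Integration.integral_diff
        integrable_continuous_interval continuous_strip_energy continuous_intros)
  also have "\<dots> = (\<Sum>p\<in>P. \<Sum>q\<in>P. scale_gap B r R (p - q))"
    unfolding integral_strip_energy[OF P] scale_gap_def
    by (simp add: sum.distrib sum_subtractf sum_distrib_left)
  finally show ?thesis unfolding n_def by simp
qed

text \<open>The first summand in the bracket is the energy at radius (B + 2) \<tau>; the second
  comes from two strips, of slopes B and -B and half-width 2 R.\<close>

definition gap_const :: "real \<Rightarrow> real \<Rightarrow> real \<Rightarrow> real" where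
  "gap_const s C B = 8 * B * (B + 2) * (2 * 2 powr s * C / (1 - 2 powr (1 - s)) * (B + 2) powr (s - 1)
     + 6 * C * (B + 2) powr s * 2 powr (s - 1))"

lemma gap_const_nonneg: "1 < s \<Longrightarrow> 0 < C \<Longrightarrow> 1 \<le> B \<Longrightarrow> 0 \<le> gap_const s C B"
proof -
  assume a: "1 < s" "0 < C" "1 \<le> B"
  then have "2 powr (1 - s) \<le> 1" using powr_less_one[of 2 "1 - s"] by simp
  then show ?thesis unfolding gap_const_def using a
    by (intro mult_nonneg_nonneg add_nonneg_nonneg divide_nonneg_nonneg) auto
qed

text \<open>For fixed \<open>p\<close> the near points are bounded by \<open>energy_le\<close>, and
  the points near the cone with apex \<open>p\<close> lie in two strips through \<open>p\<close>,
  each point there weighing 1 / \<tau>.\<close>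

lemma sum_scale_gap_le:
  assumes P: "finite P" "P \<subseteq> {0..1} \<times> {0..1}" and reg: "regular_above_scale s \<delta> C P"
    and "1 < s" "0 < C" "0 < \<delta>" "\<delta> \<le> r" "r \<le> R" "R \<le> \<tau>" "\<tau> \<le> 1" "1 \<le> B"
  shows "(\<Sum>p\<in>P. \<Sum>q\<in>P. scale_gap B r R (p - q))
    \<le> gap_const s C B * real (card P) ^ 2 * (\<tau> powr (s - 1) + R powr (s - 1) / \<tau>)"
proof -
  define n where "n = real (card P)"
  define E where "E = 2 * 2 powr s * C / (1 - 2 powr (1 - s)) * (B + 2) powr (s - 1)"
  define F where "F = 6 * C * (B + 2) powr s * 2 powr (s - 1)"
  have pos: "0 < r" "0 < R" "0 < \<tau>" using assms by auto
  have "2 powr (1 - s) \<le> 1" using powr_less_one[of 2 "1 - s"] assms by simp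
  then have E0: "0 \<le> E" unfolding E_def using assms
    by (intro mult_nonneg_nonneg divide_nonneg_nonneg) auto
  have F0: "0 \<le> F" unfolding F_def using assms by simp
  have point: "(\<Sum>q\<in>P. scale_gap B r R (p - q))
    \<le> 8 * B * (B + 2) * ((E + F) * n * (\<tau> powr (s - 1) + R powr (s - 1) / \<tau>))" for p
  proof -
    define d where "d q = dist_max p q" for q
    define X where "X q = \<bar>\<bar>snd (p - q)\<bar> - B * \<bar>fst (p - q)\<bar>\<bar>" for q
    have d: "max \<bar>fst (p - q)\<bar> \<bar>snd (p - q)\<bar> = d q" for q
      unfolding d_def dist_max_def by simp
    have "(\<Sum>q\<in>P. scale_gap B r R (p - q)) \<le> (\<Sum>q\<in>P. 8 * B * (B + 2) *
        ((if d q \<le> (B + 2) * \<tau> then 1 / max r (d q) else 0) + (if X q \<le> 2 * R then 1 / \<tau> else 0)))"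
    proof (rule sum_mono)
      fix q
      show "scale_gap B r R (p - q) \<le> 8 * B * (B + 2) *
        ((if d q \<le> (B + 2) * \<tau> then 1 / max r (d q) else 0) + (if X q \<le> 2 * R then 1 / \<tau> else 0))"
        using scale_gap_le[of r R \<tau> B "p - q"] assms pos unfolding d X_def by blast
    qed
    also have "\<dots> = 8 * B * (B + 2) * ((\<Sum>q\<in>P. if d q \<le> (B + 2) * \<tau> then 1 / max r (d q) else 0)
        + (\<Sum>q\<in>P. if X q \<le> 2 * R then 1 / \<tau> else 0))"
      unfolding sum.distrib[symmetric] sum_distrib_left ..
    also have "(\<Sum>q\<in>P. if d q \<le> (B + 2) * \<tau> then 1 / max r (d q) else 0)
        = (\<Sum>q | q \<in> P \<and> d q \<le> (B + 2) * \<tau>. 1 / max r (d q))"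
      using P(1) by (simp add: sum.inter_filter)
    also have "(\<Sum>q\<in>P. if X q \<le> 2 * R then 1 / \<tau> else 0) = real (card {q \<in> P. X q \<le> 2 * R}) * (1 / \<tau>)"
      using P(1) by (simp add: sum.inter_filter[symmetric])
    also have "8 * B * (B + 2) * ((\<Sum>q | q \<in> P \<and> d q \<le> (B + 2) * \<tau>. 1 / max r (d q))
        + real (card {q \<in> P. X q \<le> 2 * R}) * (1 / \<tau>))
      \<le> 8 * B * (B + 2) * (E * n * \<tau> powr (s - 1) + F * n * R powr (s - 1) * (1 / \<tau>))"
    proof (intro mult_left_mono add_mono mult_right_mono)
      have "r \<le> 1 * \<tau>" using assms by simp
      also have "\<dots> \<le> (B + 2) * \<tau>" using assms pos by (intro mult_right_mono) auto
      finally have "(\<Sum>q | q \<in> P \<and> d q \<le> (B + 2) * \<tau>. 1 / max r (d q))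
        \<le> 2 * 2 powr s * C / (1 - 2 powr (1 - s)) * n * ((B + 2) * \<tau>) powr (s - 1)"
        unfolding d_def n_def using assms by (intro energy_le[OF P(1) reg])
      also have "\<dots> = E * n * \<tau> powr (s - 1)"
        unfolding E_def using assms pos by (simp add: powr_mult)
      finally show "(\<Sum>q | q \<in> P \<and> d q \<le> (B + 2) * \<tau>. 1 / max r (d q)) \<le> E * n * \<tau> powr (s - 1)" .
    next
      let ?S = "\<lambda>b. {q \<in> P. \<bar>snd q - b * fst q - (snd p - b * fst p)\<bar> \<le> 2 * R}"
      have "{q \<in> P. X q \<le> 2 * R} \<subseteq> ?S B \<union> ?S (- B)"
      proof
        fix q assume q: "q \<in> {q \<in> P. X q \<le> 2 * R}"
        define u where "u = snd p - snd q"
        define v where "v = B * (fst p - fst q)"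
        \<comment> \<open>Being close to the double cone means being close to one of its two lines,
          u = v or u = -v.\<close>
        have "\<bar>\<bar>u\<bar> - \<bar>v\<bar>\<bar> \<le> 2 * R"
          using q assms unfolding X_def u_def v_def by (simp add: abs_mult)
        then have "\<bar>u - v\<bar> \<le> 2 * R \<or> \<bar>u + v\<bar> \<le> 2 * R" by linarith
        moreover have eq: "snd q - B * fst q - (snd p - B * fst p) = - (u - v)"
          "snd q - (- B) * fst q - (snd p - (- B) * fst p) = - (u + v)"
          unfolding u_def v_def by (simp_all add: algebra_simps)
        ultimately show "q \<in> ?S B \<union> ?S (- B)"
          using q unfolding Un_iff mem_Collect_eq eq abs_minus_cancel by blast
      qed
      then have "card {q \<in> P. X q \<le> 2 * R} \<le> card (?S B \<union> ?S (- B))"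
        using P(1) by (intro card_mono) auto
      also have "\<dots> \<le> card (?S B) + card (?S (- B))" by (rule card_Un_le)
      finally have "real (card {q \<in> P. X q \<le> 2 * R}) \<le> real (card (?S B)) + real (card (?S (- B)))"
        by linarith
      also have "\<dots> \<le> 3 * C * (B + 2) powr s * n * (2 * R) powr (s - 1)
          + 3 * C * (B + 2) powr s * n * (2 * R) powr (s - 1)"
        unfolding n_def using assms pos by (intro add_mono card_strip_le[OF P reg]) auto
      also have "\<dots> = F * n * R powr (s - 1)"
        unfolding F_def using pos by (simp add: powr_mult)
      finally show "real (card {q \<in> P. X q \<le> 2 * R}) \<le> F * n * R powr (s - 1)" .
    qed (use assms pos in auto)
    also have "\<dots> \<le> 8 * B * (B + 2) * ((E + F) * n * (\<tau> powr (s - 1) + R powr (s - 1) / \<tau>))"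
    proof (rule mult_left_mono)
      have "0 \<le> F * n * \<tau> powr (s - 1)" "0 \<le> E * n * (R powr (s - 1) / \<tau>)"
        using E0 F0 pos unfolding n_def by simp_all
      then show "E * n * \<tau> powr (s - 1) + F * n * R powr (s - 1) * (1 / \<tau>)
        \<le> (E + F) * n * (\<tau> powr (s - 1) + R powr (s - 1) / \<tau>)" by (simp add: algebra_simps add_divide_distrib)
    qed (use assms in auto)
    finally show ?thesis .
  qed
  have "(\<Sum>p\<in>P. \<Sum>q\<in>P. scale_gap B r R (p - q))
    \<le> (\<Sum>p\<in>P. 8 * B * (B + 2) * ((E + F) * n * (\<tau> powr (s - 1) + R powr (s - 1) / \<tau>)))"
    by (intro sum_mono point)
  also have "\<dots> = gap_const s C B * n ^ 2 * (\<tau> powr (s - 1) + R powr (s - 1) / \<tau>)"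
    unfolding gap_const_def E_def[symmetric] F_def[symmetric] n_def
    by (simp add: power2_eq_square mult_ac)
  finally show ?thesis unfolding n_def .
qed

section \<open>Slopes in short intervals\<close>

text \<open>Cells are half-open, so a pair lies in at most one cell of a given length.\<close>

definition cell_pairs ::
    "(real \<times> real) set \<Rightarrow> real \<Rightarrow> real \<Rightarrow> nat \<Rightarrow> ((real \<times> real) \<times> (real \<times> real)) set" where
  "cell_pairs P B r i = {x \<in> P \<times> P. fst (fst x) \<noteq> fst (snd x) \<and>
     -B + real i * r \<le> slope (fst x) (snd x) \<and> slope (fst x) (snd x) < -B + (real i + 1) * r}"

definition bad_cells :: "(real \<times> real) set \<Rightarrow> real \<Rightarrow> real \<Rightarrow> real \<Rightarrow> real \<Rightarrow> nat \<Rightarrow> nat set" where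
  "bad_cells P B M \<sigma> r m = {i. i < m \<and> M * real (card P) ^ 2 * r powr \<sigma> < real (card (cell_pairs P B r i))}"

lemma finite_cell_pairs: "finite P \<Longrightarrow> finite (cell_pairs P B r i)"
  unfolding cell_pairs_def by simp

lemma cell_pairs_disjoint:
  assumes "0 < r" "i \<noteq> i'" shows "cell_pairs P B r i \<inter> cell_pairs P B r i' = {}"
proof -
  have False if "x \<in> cell_pairs P B r i" "x \<in> cell_pairs P B r i'" for x
  proof -
    have "real i * r < (real i' + 1) * r" "real i' * r < (real i + 1) * r"
      using that unfolding cell_pairs_def by auto
    then have "real i < real i' + 1" "real i' < real i + 1"
      using assms(1) by (simp_all only: mult_less_cancel_right_pos)
    then show False using assms(2) by linarith
  qed
  then show ?thesis by blast
qed

lemma sum_card_cell_pairs_le: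
  assumes "finite P" "finite I" "0 < r"
  shows "(\<Sum>i\<in>I. real (card (cell_pairs P B r i))) \<le> real (card P) ^ 2"
proof -
  have "(\<Sum>i\<in>I. card (cell_pairs P B r i)) = card (\<Union>i\<in>I. cell_pairs P B r i)"
    using assms cell_pairs_disjoint finite_cell_pairs by (intro card_UN_disjoint[symmetric]) blast+
  also have "\<dots> \<le> card (P \<times> P)"
    using assms by (intro card_mono) (auto simp: cell_pairs_def)
  finally have "real (\<Sum>i\<in>I. card (cell_pairs P B r i)) \<le> real (card (P \<times> P))"
    by (simp only: of_nat_le_iff)
  then show ?thesis by (simp add: card_cartesian_product power2_eq_square)
qed

text \<open>The bad cells have total length at most h = r^(1-\<sigma>) / M, and
  \<open>sum_card_cells_le\<close> is applied with R^2 = h. The exponent, a positive power of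
  \<open>h\<close>, is what remains after optimising roughly in \<tau>.\<close>

lemma sum_bad_cells_le:
  assumes P: "finite P" "P \<subseteq> {0..1} \<times> {0..1}" and reg: "regular_above_scale s \<delta> C P"
    and s: "1 < s" "s \<le> 2" and "0 < C" "0 < \<delta>" "\<delta> \<le> r" "r \<le> 1" "1 \<le> B" "0 < \<sigma>" "\<sigma> < 1" "1 \<le> M"
    and m: "real m * r = 2 * B"
  shows "(\<Sum>i\<in>bad_cells P B M \<sigma> r m. real (card (cell_pairs P B r i)))
    \<le> (4 * gap_const s C B + 4) * real (card P) ^ 2 * (r powr (1 - \<sigma>) / M) powr ((s - 1)\<^sup>2 / 4)"
proof (cases "bad_cells P B M \<sigma> r m = {}")
  case True
  then show ?thesis using gap_const_nonneg[OF s(1)] assms by simp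
next
  case False
  define I where "I = bad_cells P B M \<sigma> r m"
  define n where "n = real (card P)"
  define h where "h = r powr (1 - \<sigma>) / M"
  define R where "R = h powr (1 / 2)"
  \<comment> \<open>This makes R^(s-1) / \<tau> = R^((s-1)/2) and \<tau>^(s-1) = R^g. For s <= 2 the
    exponent \<open>g\<close> is at most (s-1) / 2 and at most 1, so all three error terms are
    bounded by R^g.\<close>
  define \<tau> where "\<tau> = R powr ((s - 1) / 2)"
  define g where "g = (s - 1)\<^sup>2 / 2"
  have r: "0 < r" using assms by simp
  have finI: "finite I" unfolding I_def bad_cells_def by simp
  obtain i0 where "i0 \<in> I" using False unfolding I_def by blast
  then have i0: "M * n ^ 2 * r powr \<sigma> < real (card (cell_pairs P B r i0))"
    unfolding I_def bad_cells_def n_def by simp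
  also have "\<dots> \<le> n ^ 2"
    using sum_card_cell_pairs_le[OF P(1) _ r, of "{i0}" B] unfolding n_def by simp
  finally have lt: "M * n ^ 2 * r powr \<sigma> < n ^ 2" .
  then have n: "0 < n" unfolding n_def by (cases "card P = 0") auto
  \<comment> \<open>A bad cell can hold at most n^2 pairs, so its existence forces M r^\<sigma> < 1.
    This gives r <= h and hence r <= R, as the comparison of the two scales requires.\<close>
  have Mr: "M * r powr \<sigma> < 1" using lt n by (simp add: field_simps)
  have h: "0 < h" unfolding h_def using r assms by simp
  have "r powr (1 - \<sigma>) \<le> 1" using assms r by (intro powr_le1) auto
  then have h1: "h \<le> 1" unfolding h_def using assms by (simp add: field_simps)
  have R: "0 < R" "R \<le> 1" unfolding R_def using h h1 by (auto intro: powr_le1)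
  have RR: "R * R = h" unfolding R_def using h by (simp flip: powr_add)
  have "r * (M * r powr \<sigma>) \<le> r powr (1 - \<sigma>) * r powr \<sigma>"
    using Mr r by (simp flip: powr_add)
  then have "r * M \<le> r powr (1 - \<sigma>)" using r by (simp add: mult.assoc[symmetric])
  then have rh: "r \<le> h" unfolding h_def using assms by (simp add: field_simps)
  have "r * r \<le> r * 1" using r assms by (intro mult_left_mono) auto
  then have "r * r \<le> R * R" using rh RR by simp
  then have rR: "r \<le> R" using R r by (metis abs_le_square_iff abs_of_pos power2_eq_square)
  have "R = R powr 1" using R by simp
  also have "\<dots> \<le> \<tau>" unfolding \<tau>_def using R s by (intro powr_mono') auto
  finally have R\<tau>: "R \<le> \<tau>" .
  have \<tau>: "0 < \<tau>" "\<tau> \<le> 1" unfolding \<tau>_def using R s by (auto intro: powr_le1)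
  have "(s - 1)\<^sup>2 \<le> s - 1" using s mult_left_mono[of "s - 1" 1 "s - 1"] by (simp add: power2_eq_square)
  then have g: "g \<le> (s - 1) / 2" "g \<le> 1" "0 \<le> g" using s unfolding g_def by auto
  have t1: "\<tau> powr (s - 1) = R powr g"
    unfolding \<tau>_def g_def by (simp add: powr_powr power2_eq_square)
  have "R powr (s - 1) / \<tau> = R powr ((s - 1) / 2)"
  proof -
    have "(s - 1) - (s - 1) / 2 = (s - 1) / 2" by (simp add: field_simps)
    then show ?thesis unfolding \<tau>_def powr_diff[symmetric] by (rule arg_cong)
  qed
  also have "\<dots> \<le> R powr g" using R g by (intro powr_mono') auto
  finally have t2: "R powr (s - 1) / \<tau> \<le> R powr g" .
  have "R = R powr 1" using R by simp
  also have "\<dots> \<le> R powr g" using R g by (intro powr_mono') auto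
  finally have t3: "R \<le> R powr g" .
  \<comment> \<open>Each bad cell exceeds the threshold M n^2 r^\<sigma>, while disjoint cells hold
    at most n^2 pairs together.\<close>
  have cardI: "real (card I) * r \<le> R * R"
  proof -
    have "real (card I) * (M * n ^ 2 * r powr \<sigma>) = (\<Sum>i\<in>I. M * n ^ 2 * r powr \<sigma>)" by simp
    also have "\<dots> \<le> (\<Sum>i\<in>I. real (card (cell_pairs P B r i)))"
      unfolding I_def bad_cells_def n_def by (intro sum_mono) auto
    also have "\<dots> \<le> n ^ 2" unfolding n_def by (rule sum_card_cell_pairs_le[OF P(1) finI r])
    finally have "real (card I) * M * r powr \<sigma> \<le> 1" using n by (simp add: field_simps)
    then have "real (card I) * M * r powr \<sigma> * r powr (1 - \<sigma>) \<le> 1 * r powr (1 - \<sigma>)"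
      by (intro mult_right_mono) auto
    then have "real (card I) * M * r \<le> r powr (1 - \<sigma>)"
      using r by (simp add: mult.assoc flip: powr_add)
    then show ?thesis unfolding RR h_def using assms by (simp add: field_simps)
  qed
  have "(\<Sum>i\<in>I. real (card (cell_pairs P B r i)))
    \<le> 2 * (\<Sum>p\<in>P. \<Sum>q\<in>P. scale_gap B r R (p - q)) + 4 * real (card P) ^ 2 * real (card I) * r / R"
  proof (rule sum_card_cells_le[OF P(1) r R(1) m])
    show "I \<subseteq> {..<m}" unfolding I_def bad_cells_def by auto
    show "cell_pairs P B r i \<subseteq> P \<times> P" for i unfolding cell_pairs_def by auto
    fix i p q a assume pq: "(p, q) \<in> cell_pairs P B r i"
      and a: "-B + real i * r \<le> a" "a \<le> -B + (real i + 1) * r"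
    have ne: "fst p \<noteq> fst q" and PQ: "p \<in> P" "q \<in> P"
      and sl: "-B + real i * r \<le> slope p q" "slope p q < -B + (real i + 1) * r"
      using pq unfolding cell_pairs_def by auto
    have "(snd p - a * fst p) - (snd q - a * fst q) = (slope p q - a) * (fst p - fst q)"
      using ne unfolding slope_def by (simp add: field_simps)
    moreover have "\<bar>slope p q - a\<bar> \<le> r" using a sl by (simp add: algebra_simps abs_le_iff)
    moreover have "0 \<le> fst p" "fst p \<le> 1" "0 \<le> fst q" "fst q \<le> 1" using PQ P(2) by auto
    then have "\<bar>fst p - fst q\<bar> \<le> 1" by linarith
    ultimately show "\<bar>(snd p - a * fst p) - (snd q - a * fst q)\<bar> \<le> r"
      using mult_mono[of "\<bar>slope p q - a\<bar>" r "\<bar>fst p - fst q\<bar>" 1] r by (simp add: abs_mult)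
  qed
  also have "\<dots> \<le> 2 * (gap_const s C B * n ^ 2 * (R powr g + R powr g)) + 4 * n ^ 2 * R powr g"
  proof (intro add_mono mult_left_mono)
    have "(\<Sum>p\<in>P. \<Sum>q\<in>P. scale_gap B r R (p - q))
      \<le> gap_const s C B * n ^ 2 * (\<tau> powr (s - 1) + R powr (s - 1) / \<tau>)"
      unfolding n_def using assms rR R\<tau> \<tau> by (intro sum_scale_gap_le[OF P reg])
    also have "\<dots> \<le> gap_const s C B * n ^ 2 * (R powr g + R powr g)"
      using t1 t2 gap_const_nonneg[OF s(1)] assms by (intro mult_left_mono add_mono) auto
    finally show "(\<Sum>p\<in>P. \<Sum>q\<in>P. scale_gap B r R (p - q))
      \<le> gap_const s C B * n ^ 2 * (R powr g + R powr g)" .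
    have "real (card I) * r / R \<le> R" using cardI R by (simp add: field_simps)
    then have "real (card I) * r / R \<le> R powr g" using t3 by linarith
    then have "4 * n ^ 2 * (real (card I) * r / R) \<le> 4 * n ^ 2 * R powr g" by (rule mult_left_mono) simp
    then show "4 * real (card P) ^ 2 * real (card I) * r / R \<le> 4 * n ^ 2 * R powr g"
      unfolding n_def by (simp add: mult_ac)
  qed simp
  also have "\<dots> = (4 * gap_const s C B + 4) * n ^ 2 * R powr g" by (simp add: algebra_simps)
  also have "R powr g = h powr ((s - 1)\<^sup>2 / 4)" unfolding R_def g_def by (simp add: powr_powr)
  finally show ?thesis unfolding I_def n_def h_def .
qed

section \<open>Lines through good pairs\<close>

lemma powr_le_of_small:
  fixes a b e :: real
  assumes "0 < e" "0 < b" "0 < a"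
  obtains x0 where "0 < x0" "\<And>x. 0 < x \<Longrightarrow> x \<le> x0 \<Longrightarrow> a * x powr e \<le> b"
proof
  show "0 < (b / a) powr (1 / e)" using assms by simp
  fix x assume x: "0 < x" "x \<le> (b / a) powr (1 / e)"
  then have "x powr e \<le> ((b / a) powr (1 / e)) powr e" using assms by (intro powr_mono2) auto
  then have "x powr e \<le> b / a" using assms by (simp add: powr_powr)
  then show "a * x powr e \<le> b" using assms by (simp add: field_simps)
qed

text \<open>For w <= 1 a smaller exponent only weakens the bound; for w > 1 the trivial count n is
  enough, because C' >= 1.\<close>

lemma regular_above_scale_weaken:
  assumes "regular_above_scale s \<delta> C P" "finite P" "0 < \<delta>" "0 \<le> s'" "s' \<le> s" "C \<le> C'" "1 \<le> C'"
  shows "regular_above_scale s' \<delta> C' P"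
  unfolding regular_above_scale_def
proof (intro allI impI)
  fix a b w :: real assume w: "w > \<delta>"
  define c where "c = real (card (P \<inter> ({a..a + w} \<times> {b..b + w})))"
  have c: "c \<le> C * real (card P) * w powr s"
    using assms(1) w unfolding regular_above_scale_def c_def by blast
  show "c \<le> C' * real (card P) * w powr s'"
  proof (cases "w \<le> 1")
    case True
    have "C * real (card P) * w powr s \<le> C' * real (card P) * w powr s"
      using assms by (intro mult_right_mono) auto
    also have "\<dots> \<le> C' * real (card P) * w powr s'"
      using assms True w by (intro mult_left_mono powr_mono') auto
    finally show ?thesis using c by linarith
  next
    case False
    have "1 powr s' \<le> w powr s'" using assms False by (intro powr_mono2) auto
    then have "1 * 1 \<le> C' * w powr s'" using assms by (intro mult_mono) auto
    then have "real (card P) * 1 \<le> real (card P) * (C' * w powr s')" by (intro mult_left_mono) auto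
    moreover have "c \<le> real (card P)" unfolding c_def using assms(2) by (auto intro!: card_mono)
    ultimately show ?thesis by (simp add: mult_ac)
  qed
qed

section \<open>Lines, directions and slopes\<close>

lemma affine_hull_points_on:
  assumes "fst x \<noteq> fst y" "p \<in> affine hull {x, y}" "p \<in> P"
  shows "p \<in> points_on P (line_of x y)"
proof -
  obtain u v where uv: "p = u *\<^sub>R x + v *\<^sub>R y" "u + v = 1"
    using assms(2) unfolding affine_hull_2 by blast
  have "x \<in> points_on UNIV (line_of x y)" "y \<in> points_on UNIV (line_of x y)"
    using points_on_line_of[of x y UNIV] assms(1) by auto
  then have "snd x = fst (line_of x y) * fst x + snd (line_of x y)"
    "snd y = fst (line_of x y) * fst y + snd (line_of x y)" unfolding points_on_def by auto
  then have "snd p = u * (fst (line_of x y) * fst x + snd (line_of x y))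
      + v * (fst (line_of x y) * fst y + snd (line_of x y))" using uv(1) by simp
  also have "\<dots> = fst (line_of x y) * fst p + (u + v) * snd (line_of x y)"
    using uv(1) by (simp add: algebra_simps)
  finally show ?thesis using assms(3) uv(2) unfolding points_on_def by simp
qed

text \<open>Antipodal direction vectors satisfy the same linear relation, so the orientation of a
  line never matters below.\<close>

lemma line_directions_slope:
  assumes "fst x \<noteq> fst y" "u \<in> line_directions (affine hull {x, y})"
  shows "fst u \<noteq> 0" "snd u = slope x y * fst u"
proof -
  obtain p where p: "affine hull {x, y} = range (\<lambda>t. p + t *\<^sub>R u)"
    using assms(2) unfolding line_directions_def by blast
  have "x \<in> affine hull {x, y}" "y \<in> affine hull {x, y}" by (simp_all add: hull_inc)
  then obtain t t' where t: "x = p + t *\<^sub>R u" "y = p + t' *\<^sub>R u" unfolding p by auto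
  have d: "fst y - fst x = (t' - t) * fst u" "snd y - snd x = (t' - t) * snd u"
    unfolding t by (simp_all add: algebra_simps)
  then show u: "fst u \<noteq> 0" using assms(1) by auto
  have "t' - t \<noteq> 0" using d(1) assms(1) by auto
  then show "snd u = slope x y * fst u" unfolding slope_def d using u by simp
qed

text \<open>Here sin (t - t') = (a - b) cos t cos t', and slopes bounded by \<open>B\<close> force
  the square of each cosine to be at least 1 / (1 + B^2). Working with the angles themselves avoids
  branches of the arctangent.\<close>

lemma slope_dist_le:
  fixes a b B t t' :: real
  assumes "sin t = a * cos t" "sin t' = b * cos t'" "\<bar>a\<bar> \<le> B" "\<bar>b\<bar> \<le> B"
  shows "\<bar>a - b\<bar> \<le> (1 + B\<^sup>2) * \<bar>t - t'\<bar>"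
proof -
  define D where "D = 1 + B\<^sup>2"
  have D: "0 < D" unfolding D_def by (simp add: add_pos_nonneg)
  have one: "1 \<le> D * (cos u)\<^sup>2" if "sin u = c * cos u" "\<bar>c\<bar> \<le> B" for u c :: real
  proof -
    have "1 = (sin u)\<^sup>2 + (cos u)\<^sup>2" by simp
    also have "\<dots> = (1 + c\<^sup>2) * (cos u)\<^sup>2" unfolding that(1) by (simp add: algebra_simps power_mult_distrib)
    also have "\<dots> \<le> D * (cos u)\<^sup>2"
      unfolding D_def using that(2) abs_le_square_iff[of c B] by (intro mult_right_mono) auto
    finally show ?thesis .
  qed
  have "1 * 1 \<le> (D * (cos t)\<^sup>2) * (D * (cos t')\<^sup>2)" using one assms D by (intro mult_mono) auto
  then have "1\<^sup>2 \<le> (D * \<bar>cos t * cos t'\<bar>)\<^sup>2" by (simp add: power_mult_distrib power2_eq_square mult_ac)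
  then have c: "1 \<le> D * \<bar>cos t * cos t'\<bar>" by (rule power2_le_imp_le) (use D in simp)
  have "sin (t - t') = (a - b) * (cos t * cos t')"
    unfolding sin_diff assms(1,2) by (simp add: algebra_simps)
  moreover have "\<bar>sin (t - t')\<bar> \<le> \<bar>t - t'\<bar>" by (rule abs_sin_x_le_abs_x)
  ultimately have s: "\<bar>a - b\<bar> * \<bar>cos t * cos t'\<bar> \<le> \<bar>t - t'\<bar>" by (simp add: abs_mult)
  have "\<bar>a - b\<bar> * 1 \<le> \<bar>a - b\<bar> * (D * \<bar>cos t * cos t'\<bar>)" using c by (intro mult_left_mono) auto
  also have "\<dots> = D * (\<bar>a - b\<bar> * \<bar>cos t * cos t'\<bar>)" by simp
  also have "\<dots> \<le> D * \<bar>t - t'\<bar>" using s D by (intro mult_left_mono) auto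
  finally show ?thesis unfolding D_def by simp
qed

text \<open>An abscissa gap above 1 / B bounds slopes by \<open>B\<close> in the unit square.
  \<open>B\<close> is a natural number so that 2 B 2^j cells of length 2^(-j) tile the slope range
  exactly.\<close>

definition good_pairs where
  "good_pairs P B M \<sigma> \<delta> j0 = {x \<in> P \<times> P. 1 / real B < \<bar>fst (fst x) - fst (snd x)\<bar> \<and>
     card (points_on P (line_of (fst x) (snd x))) < 2 ^ j0 \<and>
     (\<forall>j i. \<delta> \<le> 1 / 2 ^ j \<longrightarrow> i \<in> bad_cells P (real B) M \<sigma> (1 / 2 ^ j) (2 * B * 2 ^ j) \<longrightarrow>
        x \<notin> cell_pairs P (real B) (1 / 2 ^ j) i)}"

lemma good_pairs_slope:
  assumes P: "P \<subseteq> {0..1} \<times> {0..1}" and B: "1 \<le> B" and x: "x \<in> good_pairs P B M \<sigma> \<delta> j0"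
  shows "fst (fst x) \<noteq> fst (snd x)" "\<bar>slope (fst x) (snd x)\<bar> < real B"
proof -
  have f: "1 / real B < \<bar>fst (snd x) - fst (fst x)\<bar>"
    using x unfolding good_pairs_def by (simp add: abs_minus_commute)
  have B0: "0 < real B" using B by simp
  then have pos: "0 < \<bar>fst (snd x) - fst (fst x)\<bar>" using f by (meson less_trans divide_pos_pos zero_less_one)
  then show "fst (fst x) \<noteq> fst (snd x)" by auto
  have "fst x \<in> {0..1} \<times> {0..1}" "snd x \<in> {0..1} \<times> {0..1}"
    using x P unfolding good_pairs_def by auto
  then have "\<bar>snd (snd x) - snd (fst x)\<bar> \<le> 1" by (auto simp: mem_Times_iff abs_le_iff)
  also have "1 < real B * \<bar>fst (snd x) - fst (fst x)\<bar>" using f B0 by (simp add: field_simps)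
  finally show "\<bar>slope (fst x) (snd x)\<bar> < real B"
    unfolding slope_def abs_divide using pos by (simp add: field_simps)
qed

text \<open>A slope window of length D \<rho> meets at most D + 2 cells of length \<rho>. A cell
  containing a good pair is not bad, so each cell that matters obeys the threshold.\<close>

lemma card_good_pairs_in_window_le:
  fixes D B :: nat and M \<rho> :: real
  assumes P: "finite P" "P \<subseteq> {0..1} \<times> {0..1}" and B: "1 \<le> B" and M: "0 \<le> M"
    and \<rho>: "\<rho> = 1 / 2 ^ j" "\<delta> \<le> \<rho>" and T: "T \<subseteq> good_pairs P B M \<sigma> \<delta> j0"
    and close: "\<And>x y. x \<in> T \<Longrightarrow> y \<in> T \<Longrightarrow>
      \<bar>slope (fst x) (snd x) - slope (fst y) (snd y)\<bar> \<le> real D * \<rho>"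
  shows "real (card T) \<le> (real D + 2) * (M * real (card P) ^ 2 * \<rho> powr \<sigma>)"
proof (cases "T = {}")
  case False
  define m where "m = 2 * B * 2 ^ j"
  define f where "f x = slope (fst x) (snd x)" for x
  define ix where "ix x = nat \<lfloor>(f x + real B) / \<rho>\<rfloor>" for x
  have \<rho>0: "0 < \<rho>" using \<rho> by simp
  have "T \<subseteq> P \<times> P" using T unfolding good_pairs_def by auto
  then have finT: "finite T" using P(1) finite_subset by blast
  have sl: "fst (fst x) \<noteq> fst (snd x) \<and> - real B < f x \<and> f x < real B" if "x \<in> T" for x
    using good_pairs_slope[OF P(2) B, of x] that T unfolding f_def by (force simp: abs_less_iff)
  have cell: "x \<in> cell_pairs P (real B) \<rho> (ix x)" "ix x < m" if x: "x \<in> T" for x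
  proof -
    have 0: "0 \<le> (f x + real B) / \<rho>" using sl[OF x] \<rho>0 by simp
    then have i: "real (ix x) \<le> (f x + real B) / \<rho>" "(f x + real B) / \<rho> < real (ix x) + 1"
      unfolding ix_def by linarith+
    then have i': "real (ix x) * \<rho> \<le> f x + real B" "f x + real B < (real (ix x) + 1) * \<rho>"
      using \<rho>0 by (simp_all add: field_simps)
    then show "x \<in> cell_pairs P (real B) \<rho> (ix x)"
      using sl[OF x] x \<open>T \<subseteq> P \<times> P\<close> unfolding cell_pairs_def f_def by auto
    have "real (ix x) * \<rho> < 2 * real B" using i' sl[OF x] by linarith
    then have "real (ix x) < real m" unfolding m_def \<rho> by (simp add: field_simps)
    then show "ix x < m" by simp
  qed
  obtain x0 where x0: "x0 \<in> T" "\<forall>x\<in>T. f x0 \<le> f x"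
    using finT False by (rule finite_has_least_value)
  have win: "ix x0 \<le> ix x" "ix x \<le> ix x0 + D + 1" if x: "x \<in> T" for x
  proof -
    have "(f x0 + real B) / \<rho> \<le> (f x + real B) / \<rho>"
      using x0 x \<rho>0 by (intro divide_right_mono) auto
    then show "ix x0 \<le> ix x" unfolding ix_def by (intro nat_mono floor_mono)
    have "f x \<le> f x0 + real D * \<rho>" using close[OF x x0(1)] unfolding f_def by linarith
    then have "(f x + real B) / \<rho> \<le> (f x0 + real B + real D * \<rho>) / \<rho>"
      using \<rho>0 by (intro divide_right_mono) auto
    also have "\<dots> = (f x0 + real B) / \<rho> + real D" using \<rho>0 by (simp add: add_divide_distrib)
    finally have "(f x + real B) / \<rho> \<le> (f x0 + real B) / \<rho> + real D" .
    moreover have "0 \<le> (f x0 + real B) / \<rho>" using sl[OF x0(1)] \<rho>0 by simp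
    moreover have "0 \<le> (f x + real B) / \<rho>" using sl[OF x] \<rho>0 by simp
    ultimately have "real (ix x) \<le> real (ix x0) + real D + 1" unfolding ix_def by linarith
    then show "ix x \<le> ix x0 + D + 1" by linarith
  qed
  define A where "A = {i \<in> {ix x0..ix x0 + D + 1}. i < m \<and> i \<notin> bad_cells P (real B) (M) \<sigma> \<rho> m}"
  have "T \<subseteq> (\<Union>i\<in>A. cell_pairs P (real B) \<rho> i)"
  proof
    fix x assume x: "x \<in> T"
    have "ix x \<notin> bad_cells P (real B) (M) \<sigma> \<rho> m"
      using x T cell[OF x] \<rho> unfolding good_pairs_def m_def by auto
    then have "ix x \<in> A" unfolding A_def using win[OF x] cell[OF x] by simp
    then show "x \<in> (\<Union>i\<in>A. cell_pairs P (real B) \<rho> i)" using cell[OF x] by blast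
  qed
  then have "card T \<le> card (\<Union>i\<in>A. cell_pairs P (real B) \<rho> i)"
    using P(1) by (intro card_mono) (auto simp: A_def finite_cell_pairs)
  also have "\<dots> \<le> (\<Sum>i\<in>A. card (cell_pairs P (real B) \<rho> i))"
    by (intro card_UN_le) (simp add: A_def)
  finally have "real (card T) \<le> real (\<Sum>i\<in>A. card (cell_pairs P (real B) \<rho> i))"
    by (simp only: of_nat_le_iff)
  also have "\<dots> = (\<Sum>i\<in>A. real (card (cell_pairs P (real B) \<rho> i)))" by simp
  also have "\<dots> \<le> (\<Sum>i\<in>A. M * real (card P) ^ 2 * \<rho> powr \<sigma>)"
    unfolding A_def bad_cells_def by (intro sum_mono) auto
  also have "\<dots> = real (card A) * (M * real (card P) ^ 2 * \<rho> powr \<sigma>)" by simp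
  also have "\<dots> \<le> (real D + 2) * (M * real (card P) ^ 2 * \<rho> powr \<sigma>)"
  proof (rule mult_right_mono)
    have "card A \<le> card {ix x0..ix x0 + D + 1}" unfolding A_def by (intro card_mono) auto
    then show "real (card A) \<le> real D + 2" by simp
  qed (use M in simp)
  finally show ?thesis .
qed (use M in simp)

text \<open>A line through a good pair carries fewer than 2^j0 points, so at most 4^j0 ordered pairs
  span it.\<close>

lemma card_good_pairs_le_lines:
  assumes P: "finite P" "P \<subseteq> {0..1} \<times> {0..1}" and B: "1 \<le> B"
  shows "card (good_pairs P B M \<sigma> \<delta> j0)
    \<le> 4 ^ j0 * card ((\<lambda>x. affine hull {fst x, snd x}) ` good_pairs P B M \<sigma> \<delta> j0)"
proof -
  define G where "G = good_pairs P B M \<sigma> \<delta> j0"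
  define \<phi> where "\<phi> x = affine hull {fst x, snd x}" for x :: "(real \<times> real) \<times> (real \<times> real)"
  have GP: "G \<subseteq> P \<times> P" unfolding G_def good_pairs_def by auto
  then have finG: "finite G" using P(1) finite_subset by blast
  have fib: "card {y \<in> G. \<phi> y = l} \<le> 4 ^ j0" if "l \<in> \<phi> ` G" for l
  proof -
    obtain x where x: "x \<in> G" "l = \<phi> x" using \<open>l \<in> \<phi> ` G\<close> by blast
    define S where "S = points_on P (line_of (fst x) (snd x))"
    have S: "card S < 2 ^ j0" using x(1) unfolding G_def good_pairs_def S_def by simp
    have finS: "finite S" using P(1) unfolding S_def points_on_def by simp
    have ne: "fst (fst x) \<noteq> fst (snd x)" using good_pairs_slope[OF P(2) B] x(1) unfolding G_def by blast
    have "{y \<in> G. \<phi> y = l} \<subseteq> S \<times> S"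
    proof
      fix y assume y: "y \<in> {y \<in> G. \<phi> y = l}"
      then have "fst y \<in> \<phi> x" "snd y \<in> \<phi> x"
        unfolding x(2)[symmetric] using hull_inc[of "fst y" "{fst y, snd y}" affine]
          hull_inc[of "snd y" "{fst y, snd y}" affine] by (auto simp: \<phi>_def)
      moreover have "fst y \<in> P" "snd y \<in> P" using y GP by auto
      ultimately have "fst y \<in> S" "snd y \<in> S"
        using affine_hull_points_on[OF ne] unfolding S_def \<phi>_def by auto
      then show "y \<in> S \<times> S" by (simp add: mem_Times_iff)
    qed
    then have "card {y \<in> G. \<phi> y = l} \<le> card (S \<times> S)" using finS by (intro card_mono) auto
    also have "\<dots> = card S * card S" by (simp add: card_cartesian_product)
    also have "\<dots> \<le> 2 ^ j0 * 2 ^ j0" using S by (intro mult_le_mono) auto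
    also have "\<dots> = 4 ^ j0" by (simp flip: power_mult_distrib)
    finally show ?thesis .
  qed
  have "G = (\<Union>l\<in>\<phi> ` G. {y \<in> G. \<phi> y = l})" by auto
  then have "card G \<le> (\<Sum>l\<in>\<phi> ` G. card {y \<in> G. \<phi> y = l})"
    using card_UN_le[of "\<phi> ` G" "\<lambda>l. {y \<in> G. \<phi> y = l}"] finG by simp
  also have "\<dots> \<le> (\<Sum>l\<in>\<phi> ` G. 4 ^ j0)" by (intro sum_mono fib)
  finally show ?thesis unfolding G_def \<phi>_def by (simp add: mult.commute)
qed

text \<open>\<open>hV\<close> controls pairs with close abscissae (\<open>V\<close>),
  \<open>hR\<close> and \<open>h\<delta>\<close> pairs on rich lines (\<open>Q\<close>), and
  \<open>hM\<close> pairs in bad cells (\<open>U\<close>), each by n^2 / 8.\<close>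

lemma card_good_pairs_ge:
  fixes B j0 :: nat and M g :: real
  assumes P: "finite P" "P \<subseteq> {0..1} \<times> {0..1}" and reg: "regular_above_scale s \<delta> C P"
    and s: "1 < s" "s \<le> 2" and C: "0 < C" and \<delta>: "0 < \<delta>" "\<delta> < 1 / real B" and B: "1 \<le> B"
    and \<sigma>: "0 < \<sigma>" "\<sigma> < 1" and M: "1 \<le> M" and j0: "1 \<le> j0" and g: "g = (s - 1)\<^sup>2 / 4"
    and hV: "3 * C * 2 powr s * (1 / real B) powr (s - 1) \<le> 1 / 8"
    and hR: "18432 / 2 ^ j0 \<le> (1 / 16 :: real)"
    and h\<delta>: "96 * (3 * C * (real B + 2) powr s * (2 * \<delta>) powr (s - 1)) \<le> 1 / 16"
    and hM: "(4 * gap_const s C (real B) + 4) * ((1 / M) powr g / (1 - 2 powr (- ((1 - \<sigma>) * g)))) \<le> 1 / 8"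
  shows "real (card P) ^ 2 / 2 \<le> real (card (good_pairs P B M \<sigma> \<delta> j0))"
proof -
  define n where "n = real (card P)"
  define V where "V = {x \<in> P \<times> P. \<bar>fst (fst x) - fst (snd x)\<bar> \<le> 1 / real B}"
  define Q where "Q = {x \<in> P \<times> P. fst (fst x) \<noteq> fst (snd x) \<and> \<bar>slope (fst x) (snd x)\<bar> \<le> real B \<and>
       2 ^ j0 \<le> card (points_on P (line_of (fst x) (snd x)))}"
  define J where "J = {j::nat. \<delta> \<le> 1 / 2 ^ j}"
  define I where "I j = bad_cells P (real B) M \<sigma> (1 / 2 ^ j) (2 * B * 2 ^ j)" for j
  define U where "U = (\<Union>j\<in>J. \<Union>i\<in>I j. cell_pairs P (real B) (1 / 2 ^ j) i)"
  define G where "G = good_pairs P B M \<sigma> \<delta> j0"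
  have B0: "1 \<le> real B" using B by simp
  have finJ: "finite J" unfolding J_def using \<delta>(1) by (rule finite_dyadic_above)
  have finI: "finite (I j)" for j unfolding I_def bad_cells_def by simp
  have B1: "1 / real B \<le> 1" using B0 by simp
  have \<delta>1: "\<delta> \<le> 1" using \<delta>(2) B1 by linarith

  have cV: "real (card V) \<le> n ^ 2 / 8"
  proof -
    have "V \<subseteq> Sigma P (\<lambda>p. {q \<in> P. \<bar>fst q - fst p\<bar> \<le> 1 / real B})"
      unfolding V_def by (auto simp: abs_minus_commute)
    then have "card V \<le> card (Sigma P (\<lambda>p. {q \<in> P. \<bar>fst q - fst p\<bar> \<le> 1 / real B}))"
      using P(1) by (intro card_mono) auto
    also have "\<dots> = (\<Sum>p\<in>P. card {q \<in> P. \<bar>fst q - fst p\<bar> \<le> 1 / real B})"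
      using P(1) by (intro card_SigmaI) auto
    finally have "real (card V) \<le> real (\<Sum>p\<in>P. card {q \<in> P. \<bar>fst q - fst p\<bar> \<le> 1 / real B})"
      by (simp only: of_nat_le_iff)
    also have "\<dots> = (\<Sum>p\<in>P. real (card {q \<in> P. \<bar>fst q - fst p\<bar> \<le> 1 / real B}))" by simp
    also have "\<dots> \<le> (\<Sum>p\<in>P. 3 * C * 2 powr s * real (card P) * (1 / real B) powr (s - 1))"
      using C \<delta> B1 by (intro sum_mono card_vertical_strip_le[OF P reg]) auto
    also have "\<dots> = (3 * C * 2 powr s * (1 / real B) powr (s - 1)) * n ^ 2"
      unfolding n_def by (simp add: power2_eq_square)
    also have "\<dots> \<le> 1 / 8 * n ^ 2" using hV by (intro mult_right_mono) auto
    finally show ?thesis by simp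
  qed

  have cQ: "real (card Q) \<le> n ^ 2 / 8"
  proof -
    \<comment> \<open>A line is enclosed in a strip of half-width 2 \<delta>, a width just above the
      scale at which regularity starts.\<close>
    define m where "m = 3 * C * (real B + 2) powr s * n * (2 * \<delta>) powr (s - 1)"
    have "real (card Q) \<le> 18432 * n ^ 2 / 2 ^ j0 + 96 * n * m"
      unfolding Q_def n_def
    proof (rule card_pairs_on_rich_lines_le[OF P(1) j0])
      show "0 \<le> m" unfolding m_def n_def using C by simp
      fix l :: "real \<times> real" assume l: "\<bar>fst l\<bar> \<le> real B"
      have "points_on P l \<subseteq> {q \<in> P. \<bar>snd q - fst l * fst q - snd l\<bar> \<le> 2 * \<delta>}"
        using \<delta> unfolding points_on_def by auto
      then have "card (points_on P l) \<le> card {q \<in> P. \<bar>snd q - fst l * fst q - snd l\<bar> \<le> 2 * \<delta>}"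
        using P(1) by (intro card_mono) auto
      then have "real (card (points_on P l)) \<le> real (card {q \<in> P. \<bar>snd q - fst l * fst q - snd l\<bar> \<le> 2 * \<delta>})"
        by simp
      also have "\<dots> \<le> m"
        unfolding m_def n_def using C \<delta> \<delta>1 l by (intro card_strip_le[OF P reg]) auto
      finally show "real (card (points_on P l)) \<le> m" .
    qed
    also have "\<dots> = (18432 / 2 ^ j0) * n ^ 2
        + (96 * (3 * C * (real B + 2) powr s * (2 * \<delta>) powr (s - 1))) * n ^ 2"
      unfolding m_def by (simp add: power2_eq_square)
    also have "\<dots> \<le> 1 / 16 * n ^ 2 + 1 / 16 * n ^ 2"
      using hR h\<delta> by (intro add_mono mult_right_mono) auto
    finally show ?thesis by simp
  qed

  have cU: "real (card U) \<le> n ^ 2 / 8"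
  proof -
    define q where "q = 2 powr (- ((1 - \<sigma>) * g))"
    define E where "E = 4 * gap_const s C (real B) + 4"
    have E: "0 \<le> E" unfolding E_def using gap_const_nonneg[OF s(1) C B0] by simp
    have "0 < g" unfolding g using s by simp
    then have q: "0 \<le> q" "q < 1" unfolding q_def using \<sigma> by (auto simp: powr_less_one)
    have "card U \<le> (\<Sum>j\<in>J. card (\<Union>i\<in>I j. cell_pairs P (real B) (1 / 2 ^ j) i))"
      unfolding U_def by (rule card_UN_le[OF finJ])
    also have "\<dots> \<le> (\<Sum>j\<in>J. \<Sum>i\<in>I j. card (cell_pairs P (real B) (1 / 2 ^ j) i))"
      by (intro sum_mono card_UN_le finI)
    finally have "real (card U) \<le> real (\<Sum>j\<in>J. \<Sum>i\<in>I j. card (cell_pairs P (real B) (1 / 2 ^ j) i))"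
      by (simp only: of_nat_le_iff)
    also have "\<dots> = (\<Sum>j\<in>J. \<Sum>i\<in>I j. real (card (cell_pairs P (real B) (1 / 2 ^ j) i)))" by simp
    also have "\<dots> \<le> (\<Sum>j\<in>J. E * n ^ 2 * ((1 / M) powr g * q ^ j))"
    proof (rule sum_mono)
      fix j assume j: "j \<in> J"
      have "(\<Sum>i\<in>I j. real (card (cell_pairs P (real B) (1 / 2 ^ j) i)))
        \<le> E * n ^ 2 * ((1 / 2 ^ j) powr (1 - \<sigma>) / M) powr ((s - 1)\<^sup>2 / 4)"
        unfolding I_def E_def n_def
        by (rule sum_bad_cells_le[OF P reg s C \<delta>(1) _ _ B0 \<sigma> M])
          (use j in \<open>auto simp: J_def field_simps\<close>)
      also have "((1 / 2 ^ j) powr (1 - \<sigma>) / M) powr ((s - 1)\<^sup>2 / 4) = (1 / M) powr g * q ^ j"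
      proof -
        have "(1 / 2 ^ j :: real) = 2 powr (- real j)"
          by (simp add: powr_minus powr_realpow divide_inverse)
        then have "((1 / 2 ^ j) powr (1 - \<sigma>)) powr g = 2 powr (- real j * (1 - \<sigma>) * g)"
          by (simp add: powr_powr)
        also have "- real j * (1 - \<sigma>) * g = - ((1 - \<sigma>) * g) * real j" by simp
        also have "2 powr \<dots> = q ^ j" unfolding q_def by (simp add: powr_powr flip: powr_realpow)
        finally have "((1 / 2 ^ j) powr (1 - \<sigma>)) powr g = q ^ j" .
        moreover have "((1 / 2 ^ j) powr (1 - \<sigma>) / M) powr g
          = (1 / M) powr g * ((1 / 2 ^ j) powr (1 - \<sigma>)) powr g"
          using M by (simp flip: powr_mult)
        ultimately show ?thesis unfolding g[symmetric] by simp
      qed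
      finally show "(\<Sum>i\<in>I j. real (card (cell_pairs P (real B) (1 / 2 ^ j) i)))
        \<le> E * n ^ 2 * ((1 / M) powr g * q ^ j)" .
    qed
    also have "\<dots> = E * n ^ 2 * ((1 / M) powr g * (\<Sum>j\<in>J. q ^ j))"
      by (simp only: sum_distrib_left)
    also have "\<dots> \<le> E * n ^ 2 * ((1 / M) powr g * (1 / (1 - q)))"
      using E q finJ by (intro mult_left_mono sum_geometric_subset_le) auto
    also have "\<dots> = (E * ((1 / M) powr g / (1 - q))) * n ^ 2" by simp
    also have "\<dots> \<le> 1 / 8 * n ^ 2" using hM unfolding E_def q_def by (intro mult_right_mono) auto
    finally show ?thesis by simp
  qed

  have "P \<times> P \<subseteq> G \<union> (V \<union> (Q \<union> U))"
  proof
    fix x assume x: "x \<in> P \<times> P"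
    show "x \<in> G \<union> (V \<union> (Q \<union> U))"
    proof (rule ccontr)
      assume "x \<notin> G \<union> (V \<union> (Q \<union> U))"
      then have n: "x \<notin> G" "x \<notin> V" "x \<notin> Q" "x \<notin> U" by auto
      have f: "1 / real B < \<bar>fst (fst x) - fst (snd x)\<bar>" using n(2) x unfolding V_def by auto
      have U: "\<forall>j i. \<delta> \<le> 1 / 2 ^ j \<longrightarrow> i \<in> bad_cells P (real B) M \<sigma> (1 / 2 ^ j) (2 * B * 2 ^ j) \<longrightarrow>
        x \<notin> cell_pairs P (real B) (1 / 2 ^ j) i"
        using n(4) unfolding U_def J_def I_def by blast
      then have "\<not> card (points_on P (line_of (fst x) (snd x))) < 2 ^ j0"
        using n(1) x f unfolding G_def good_pairs_def by blast
      \<comment> \<open>With this exponent the richness condition always holds, so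
        \<open>good_pairs_slope\<close> becomes available for \<open>x\<close> although its line is
        rich.\<close>
      moreover have "x \<in> good_pairs P B M \<sigma> \<delta> (card P + 1)"
      proof -
        have "card (points_on P (line_of (fst x) (snd x))) \<le> card P"
          using P(1) unfolding points_on_def by (intro card_mono) auto
        also have "\<dots> < card P + 1" by simp
        also have "\<dots> < 2 ^ (card P + 1)" by (rule less_exp)
        finally show ?thesis using x f U unfolding good_pairs_def by blast
      qed
      then have "fst (fst x) \<noteq> fst (snd x)" "\<bar>slope (fst x) (snd x)\<bar> < real B"
        using good_pairs_slope[OF P(2) B] by blast+
      ultimately show False using n(3) x unfolding Q_def by auto
    qed
  qed
  then have "card (P \<times> P) \<le> card (G \<union> (V \<union> (Q \<union> U)))"
    using P(1) finJ finI unfolding G_def good_pairs_def V_def Q_def U_def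
    by (intro card_mono) (auto simp: finite_cell_pairs)
  also have "\<dots> \<le> card G + (card V + (card Q + card U))"
    by (meson card_Un_le add_left_mono order_trans)
  finally have "real (card (P \<times> P)) \<le> real (card G) + (real (card V) + (real (card Q) + real (card U)))"
    by linarith
  moreover have "real (card (P \<times> P)) = n ^ 2" unfolding n_def by (simp add: card_cartesian_product power2_eq_square)
  ultimately show ?thesis using cV cQ cU unfolding n_def[symmetric] G_def by linarith
qed

text \<open>Constants are fixed in the order \<open>B\<close>, \<open>M\<close>,
  \<open>\<delta>0\<close>, \<open>K\<close>: \<open>B\<close> by the vertical strips,
  \<open>M\<close> by the bad cells for that \<open>B\<close>, and \<open>\<delta>0\<close> by the
  requirement that lines hold a small proportion of \<open>P\<close>.\<close>

theorem theorem4p1: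
  fixes s \<sigma> C :: real
  assumes "s > 1" and "\<sigma> < 1" and "C > 0"
  shows "\<exists>K>0. \<exists>\<delta>\<^sub>0>0. \<forall>\<delta> P. 0 < \<delta> \<and> \<delta> \<le> \<delta>\<^sub>0 \<and>
           finite P \<and> P \<subseteq> {0..1} \<times> {0..1} \<and> regular_above_scale s \<delta> C P \<longrightarrow>
           (\<exists>L \<subseteq> spanned_lines P.
              real (card L) \<ge> real (card P) ^ 2 / K \<and>
              (\<forall>I r. circle_interval I r \<and> r \<ge> \<delta> \<longrightarrow>
                 real (card {l \<in> L. line_directions l \<inter> I \<noteq> {}})
                   \<le> K * real (card L) * r powr \<sigma>))"
proof -
  \<comment> \<open>Reduction to 1 < s <= 2, C >= 1 and 1/2 <= \<sigma> < 1. Enlarging \<sigma>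
    strengthens the bound for r <= 1, and arcs with r > 1 are treated separately.\<close>
  define s' where "s' = min s 2"
  define C' where "C' = max C 1"
  define \<sigma>' where "\<sigma>' = max \<sigma> (1 / 2)"
  define g where "g = (s' - 1)\<^sup>2 / 4"
  \<comment> \<open>2^20 exceeds 16 * 18432, as \<open>hR\<close> demands.\<close>
  define j0 :: nat where "j0 = 20"
  have s': "1 < s'" "s' \<le> 2" "s' \<le> s" using assms unfolding s'_def by auto
  have C': "0 < C'" "C \<le> C'" "1 \<le> C'" using assms unfolding C'_def by auto
  have \<sigma>': "0 < \<sigma>'" "\<sigma>' < 1" "\<sigma> \<le> \<sigma>'" using assms unfolding \<sigma>'_def by auto
  have g0: "0 < g" using s' unfolding g_def by simp
  obtain x0 where x0: "x0 > 0" "\<And>x. 0 < x \<Longrightarrow> x \<le> x0 \<Longrightarrow> 3 * C' * 2 powr s' * x powr (s' - 1) \<le> 1 / 8"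
    using powr_le_of_small[of "s' - 1" "1 / 8" "3 * C' * 2 powr s'"] s' C' by auto
  obtain B :: nat where B: "max 1 (1 / x0) \<le> real B" using real_arch_simple by blast
  have B1: "1 \<le> B" "1 \<le> real B" using B by simp_all
  have "1 / real B \<le> x0" using B x0(1) B1 by (simp add: field_simps)
  then have hV: "3 * C' * 2 powr s' * (1 / real B) powr (s' - 1) \<le> 1 / 8" using x0(2) B1 by simp
  define E where "E = (4 * gap_const s' C' (real B) + 4) / (1 - 2 powr (- ((1 - \<sigma>') * g)))"
  have "2 powr (- ((1 - \<sigma>') * g)) < 1" using \<sigma>' g0 by (simp add: powr_less_one)
  then have "0 < E" unfolding E_def using gap_const_nonneg[OF s'(1) C'(1) B1(2)] by simp
  then obtain y0 where y0: "y0 > 0" "\<And>x. 0 < x \<Longrightarrow> x \<le> y0 \<Longrightarrow> E * x powr g \<le> 1 / 8"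
    using powr_le_of_small[of g "1 / 8" E] g0 by auto
  define M where "M = max 1 (1 / y0)"
  have M: "1 \<le> M" unfolding M_def by simp
  have "1 / M \<le> y0" unfolding M_def using y0(1) by (simp add: field_simps max_def)
  then have "E * (1 / M) powr g \<le> 1 / 8" using y0(2) M by simp
  then have hM: "(4 * gap_const s' C' (real B) + 4) * ((1 / M) powr g / (1 - 2 powr (- ((1 - \<sigma>') * g)))) \<le> 1 / 8"
    unfolding E_def by simp
  have "0 < 96 * (3 * C' * (real B + 2) powr s')" using C' B1 by simp
  then obtain z0 where z0: "z0 > 0"
    "\<And>x. 0 < x \<Longrightarrow> x \<le> z0 \<Longrightarrow> 96 * (3 * C' * (real B + 2) powr s') * x powr (s' - 1) \<le> 1 / 16"
    using powr_le_of_small[of "s' - 1" "1 / 16" "96 * (3 * C' * (real B + 2) powr s')"] s' by auto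
  \<comment> \<open>The first entry yields \<open>h\<delta>\<close>; the second makes regularity
    applicable to vertical strips of half-width 1 / B.\<close>
  define \<delta>0 where "\<delta>0 = min (z0 / 2) (1 / (2 * real B))"
  have \<delta>0: "0 < \<delta>0" unfolding \<delta>0_def using z0(1) B1 by simp
  \<comment> \<open>The Lipschitz constant of the slope as a function of the angle, from
    \<open>slope_dist_le\<close>.\<close>
  define D where "D = 1 + B\<^sup>2"
  \<comment> \<open>The first term serves arcs with r <= 1. For longer arcs, where the count is
    bounded by \<open>card L\<close>, the second term handles negative \<sigma> and the 1 handles
    the rest.\<close>
  define K where "K = 4 * 4 ^ j0 * (real D + 2) * M + (2 * pi) powr (- \<sigma>) + 1"
  have K1: "4 * 4 ^ j0 * (real D + 2) * M \<le> K" "(2 * pi) powr (- \<sigma>) \<le> K" "1 \<le> K"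
    unfolding K_def using M by simp_all
  have "1 * 1 \<le> (real D + 2) * M" using M by (intro mult_mono) auto
  then have "4 * 4 ^ j0 * 1 \<le> 4 * 4 ^ j0 * ((real D + 2) * M)" by (intro mult_left_mono) auto
  moreover have "(0::real) \<le> 4 ^ j0" by simp
  ultimately have K2: "2 * 4 ^ j0 \<le> K" using K1(1) by (simp only: mult.assoc)
  have K0: "0 < K" using K1(3) by simp
  show ?thesis
  proof (rule exI[of _ K], rule conjI[OF K0], rule exI[of _ \<delta>0], rule conjI[OF \<delta>0], intro allI impI)
    fix \<delta> and P :: "(real \<times> real) set"
    assume asm: "0 < \<delta> \<and> \<delta> \<le> \<delta>0 \<and> finite P \<and> P \<subseteq> {0..1} \<times> {0..1} \<and> regular_above_scale s \<delta> C P"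
    then have \<delta>: "0 < \<delta>" "\<delta> \<le> \<delta>0" and P: "finite P" "P \<subseteq> {0..1} \<times> {0..1}"
      and reg0: "regular_above_scale s \<delta> C P" by auto
    have reg: "regular_above_scale s' \<delta> C' P"
      using regular_above_scale_weaken[OF reg0 P(1) \<delta>(1) _ s'(3) C'(2,3)] s' by simp
    have "2 * \<delta> \<le> z0" "\<delta> \<le> 1 / (2 * real B)" using \<delta>(2) unfolding \<delta>0_def by auto
    then have h\<delta>: "96 * (3 * C' * (real B + 2) powr s' * (2 * \<delta>) powr (s' - 1)) \<le> 1 / 16"
      and \<delta>B: "\<delta> < 1 / real B"
      using z0(2)[of "2 * \<delta>"] \<delta>(1) B1 by (simp_all add: field_simps)
    define n where "n = real (card P)"
    define G where "G = good_pairs P B M \<sigma>' \<delta> j0"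
    define \<phi> where "\<phi> x = affine hull {fst x, snd x}" for x :: "(real \<times> real) \<times> (real \<times> real)"
    define L where "L = \<phi> ` G"
    have GP: "G \<subseteq> P \<times> P" unfolding G_def good_pairs_def by auto
    then have finG: "finite G" using P(1) finite_subset by blast
    then have finL: "finite L" unfolding L_def by simp
    have hR: "18432 / 2 ^ j0 \<le> (1 / 16 :: real)" unfolding j0_def by simp
    have "n ^ 2 / 2 \<le> real (card G)"
      unfolding n_def G_def
      by (rule card_good_pairs_ge[OF P reg s'(1,2) C'(1) \<delta>(1) \<delta>B B1(1) \<sigma>'(1,2) M _ g_def hV hR h\<delta> hM])
        (simp add: j0_def)
    also have "card G \<le> 4 ^ j0 * card L"
      unfolding G_def L_def \<phi>_def by (rule card_good_pairs_le_lines[OF P B1(1)])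
    then have "real (card G) \<le> real (4 ^ j0 * card L)" by (simp only: of_nat_le_iff)
    finally have nL: "n ^ 2 \<le> 2 * 4 ^ j0 * real (card L)" by simp
    have Gsl: "fst (fst x) \<noteq> fst (snd x)" "\<bar>slope (fst x) (snd x)\<bar> < real B" if "x \<in> G" for x
      using good_pairs_slope[OF P(2) B1(1)] that unfolding G_def by blast+
    show "\<exists>L \<subseteq> spanned_lines P. real (card L) \<ge> real (card P) ^ 2 / K \<and>
      (\<forall>I r. circle_interval I r \<and> r \<ge> \<delta> \<longrightarrow>
         real (card {l \<in> L. line_directions l \<inter> I \<noteq> {}}) \<le> K * real (card L) * r powr \<sigma>)"
    proof (intro exI[of _ L] conjI allI impI)
      show "L \<subseteq> spanned_lines P"
      proof
        fix l assume "l \<in> L"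
        then obtain x where x: "x \<in> G" "l = affine hull {fst x, snd x}" unfolding L_def \<phi>_def by blast
        moreover have "fst x \<in> P" "snd x \<in> P" "fst x \<noteq> snd x" using x(1) GP Gsl[OF x(1)] by auto
        ultimately show "l \<in> spanned_lines P" unfolding spanned_lines_def by blast
      qed
      have "n ^ 2 \<le> K * real (card L)" using nL mult_right_mono[OF K2, of "real (card L)"] by simp
      then show "real (card L) \<ge> real (card P) ^ 2 / K" unfolding n_def using K0 by (simp add: field_simps)
    next
      fix I r assume Ir: "circle_interval I r \<and> r \<ge> \<delta>"
      have r: "0 < r" "r \<le> 2 * pi" "\<delta> \<le> r" using Ir \<delta>(1) unfolding circle_interval_def by auto
      define N where "N = {l \<in> L. line_directions l \<inter> I \<noteq> {}}"
      have "real (card N) \<le> K * real (card L) * r powr \<sigma>"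
      proof (cases "r \<le> 1")
        case False
        have "1 \<le> K * r powr \<sigma>"
        proof (cases "0 \<le> \<sigma>")
          case True
          then have "1 \<le> r powr \<sigma>" using False by (simp add: ge_one_powr_ge_zero)
          then show ?thesis using K1(3) mult_mono[of 1 K 1 "r powr \<sigma>"] by simp
        next
          case neg: False
          have "1 = (2 * pi) powr (- \<sigma>) * (2 * pi) powr \<sigma>" by (simp flip: powr_add)
          also have "\<dots> \<le> K * r powr \<sigma>"
            using K1 neg r by (intro mult_mono powr_mono2') auto
          finally show ?thesis .
        qed
        then have "real (card L) * 1 \<le> real (card L) * (K * r powr \<sigma>)" by (intro mult_left_mono) auto
        moreover have "card N \<le> card L" unfolding N_def using finL by (intro card_mono) auto
        ultimately show ?thesis by (simp add: mult_ac)
      next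
        case True
        \<comment> \<open>The dyadic length lies between r and 2 r, so it is at least \<delta> and
          its bad cells have been removed.\<close>
        obtain j where j: "r \<le> 1 / 2 ^ j" "1 / 2 ^ j < 2 * r" using dyadic_scale[OF r(1) True] by blast
        define \<rho> :: real where "\<rho> = 1 / 2 ^ j"
        define T where "T = {x \<in> G. line_directions (\<phi> x) \<inter> I \<noteq> {}}"
        have "N \<subseteq> \<phi> ` T" unfolding N_def L_def T_def by blast
        moreover have finT: "finite T" using finG unfolding T_def by simp
        ultimately have "card N \<le> card (\<phi> ` T)" by (intro card_mono) auto
        also have "\<dots> \<le> card T" using finT by (rule card_image_le)
        finally have NT: "card N \<le> card T" .
        obtain a where a: "I \<subseteq> (\<lambda>t. (cos t, sin t)) ` {a..a + r}"
          using Ir unfolding circle_interval_def by blast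
        have ang: "\<exists>t\<in>{a..a + r}. sin t = slope (fst x) (snd x) * cos t" if xT: "x \<in> T" for x
        proof -
          obtain u where u: "u \<in> line_directions (\<phi> x)" "u \<in> I" and xG: "x \<in> G"
            using xT unfolding T_def by blast
          obtain t where "t \<in> {a..a + r}" "u = (cos t, sin t)" using a u(2) by blast
          moreover have "snd u = slope (fst x) (snd x) * fst u"
            using line_directions_slope(2)[OF Gsl(1)[OF xG]] u(1) unfolding \<phi>_def by blast
          ultimately show ?thesis by (intro bexI[of _ t]) simp_all
        qed
        have "real (card T) \<le> (real D + 2) * (M * real (card P) ^ 2 * \<rho> powr \<sigma>')"
        proof (rule card_good_pairs_in_window_le[OF P B1(1) _ \<rho>_def])
          show "\<delta> \<le> \<rho>" using r j unfolding \<rho>_def by linarith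
          show "T \<subseteq> good_pairs P B M \<sigma>' \<delta> j0" unfolding T_def G_def by blast
          fix x y assume xy: "x \<in> T" "y \<in> T"
          obtain t where t: "t \<in> {a..a + r}" "sin t = slope (fst x) (snd x) * cos t"
            using ang[OF xy(1)] by blast
          obtain t' where t': "t' \<in> {a..a + r}" "sin t' = slope (fst y) (snd y) * cos t'"
            using ang[OF xy(2)] by blast
          have "\<bar>slope (fst x) (snd x)\<bar> \<le> real B" "\<bar>slope (fst y) (snd y)\<bar> \<le> real B"
            using Gsl(2) xy unfolding T_def by (simp_all add: less_imp_le)
          then have "\<bar>slope (fst x) (snd x) - slope (fst y) (snd y)\<bar> \<le> (1 + (real B)\<^sup>2) * \<bar>t - t'\<bar>"
            by (rule slope_dist_le[OF t(2) t'(2)])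
          also have "\<dots> \<le> (1 + (real B)\<^sup>2) * \<rho>"
            using t(1) t'(1) j(1) unfolding \<rho>_def by (intro mult_left_mono) (auto simp: abs_le_iff)
          finally show "\<bar>slope (fst x) (snd x) - slope (fst y) (snd y)\<bar> \<le> real D * \<rho>"
            unfolding D_def by simp
        qed (use M in simp)
        also have "\<dots> \<le> (real D + 2) * (M * (2 * 4 ^ j0 * real (card L)) * (2 * r powr \<sigma>))"
        proof (intro mult_left_mono mult_mono)
          \<comment> \<open>The lower bound on \<open>card L\<close> converts a count relative to
            n^2 into one relative to \<open>card L\<close>.\<close>
          show "real (card P) ^ 2 \<le> 2 * 4 ^ j0 * real (card L)" using nL unfolding n_def .
          have "\<rho> powr \<sigma>' \<le> (2 * r) powr \<sigma>'"
            using j(2) \<sigma>' unfolding \<rho>_def by (intro powr_mono2) auto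
          also have "\<dots> = 2 powr \<sigma>' * r powr \<sigma>'" using r by (simp add: powr_mult)
          also have "\<dots> \<le> 2 powr 1 * r powr \<sigma>"
            using \<sigma>' r True by (intro mult_mono powr_mono powr_mono') auto
          finally show "\<rho> powr \<sigma>' \<le> 2 * r powr \<sigma>" by simp
        qed (use M in auto)
        also have "\<dots> = (4 * 4 ^ j0 * (real D + 2) * M) * real (card L) * r powr \<sigma>" by simp
        also have "\<dots> \<le> K * real (card L) * r powr \<sigma>" using K1(1) by (intro mult_right_mono) auto
        finally show ?thesis using NT by linarith
      qed
      then show "real (card {l \<in> L. line_directions l \<inter> I \<noteq> {}}) \<le> K * real (card L) * r powr \<sigma>"
        unfolding N_def .
    qed
  qed
qed

end
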